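(* Let $\mathcal F$ be an Ore forest-skein category and let $G=\mathrm{Frac}(\mathcal F,1)$ and $H=\mathrm{Frac}(\mathcal F_\infty)$. For each colour $a$ of $\mathcal F$ there exists an injective group morphism $\gamma_a:H\to G$. For each $k\ge1$ there exists an injective group morphism $\eta_k:G\to H$. In particular, any property of groups that is closed under taking subgroups is either satisfied by both $G$ and $H$ or by neither of them.
   Context: Trees are finite ordered rooted binary trees; $I$ is the trivial tree. A forest is a finite list of trees, with roots and leaves ordered from left to right. A coloured forest over a nonempty set $S$ has each interior (non-leaf) vertex labelled by an element of $S$. If $f$ has as many leaves as $g$ has roots, $f\circ g=fg$ is the stacking of $g$ on top of $f$; $f\otimes g$ is horizontal concatenation. Given a set $R$ of pairs of coloured trees with the same number of leaves, $\mathrm{ForC}\langle S\mid R\rangle$ is the quotient of the set of coloured forests over $S$ by the smallest equivalence relation containing $R$ and closed under composition and tensor product with forests, a small monoidal category. A forest-skein category is a category of this form; its colours are the elements of $S$ (or, abstractly, its trees with two leaves). It is an Ore category if it is left-cancellative ($fg=fh\Rightarrow g=h$) and for all $f,g$ with the same number of roots there are $p,q$ with $fp=gq$. $\mathrm{Frac}(\mathcal F,1)$ is the group of classes $[t,s]$ of pairs of trees of $\mathcal F$ with the same number of leaves modulo the relation generated by $(t,s)\sim(tf,sf)$, with $[t,s][t',s']=[tp,s'p']$ whenever $sp=t'p'$. $\mathcal F_\infty$ is the monoid of sequences $(f_n)_{n\ge1}$ of trees of $\mathcal F$ with all but finitely many $f_n$ trivial, composed by stacking (the leaves of the first, ordered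 from left to right, are glued to the roots of the second). It is left-cancellative and any two elements have a common right-multiple; $\mathrm{Frac}(\mathcal F_\infty)$ is its group of right fractions $[f,g]=fg^{-1}$. *)

theory Defs
  imports "HOL-Algebra.Group" "HOL-Library.Tree"
begin

section \<open>Coloured forests\<close>

text \<open>
  A tree coloured over the set \<open>S\<close> is an element of the library type \<^typ>\<open>'a tree\<close>, where the type
  \<open>'a\<close> plays the role of the nonempty set \<open>S\<close>: interior vertices carry a colour, leaves carry nothing.
  The trivial tree is \<^term>\<open>Leaf\<close>, and \<^term>\<open>size1 t\<close> is the number of leaves of \<open>t\<close>.
\<close>

type_synonym 'a forest = "'a tree list"

definition leaves :: "'a forest \<Rightarrow> nat" where
  "leaves f = (\<Sum>t\<leftarrow>f. size1 t)"

text \<open>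
  \<open>graft t g\<close> glues the roots of the forest \<open>g\<close> to the leaves of the tree \<open>t\<close>, from left to right;
  it is meaningful if \<^prop>\<open>size1 t = length g\<close>. Likewise \<open>stack f g\<close> is the composition
  \<open>f \<circ> g\<close> (with \<open>g\<close> on top of \<open>f\<close>) if \<^prop>\<open>leaves f = length g\<close>.
\<close>

primrec graft :: "'a tree \<Rightarrow> 'a forest \<Rightarrow> 'a tree" where
  "graft Leaf g = hd g"
| "graft (Node l a r) g = Node (graft l (take (size1 l) g)) a (graft r (drop (size1 l) g))"

primrec stack :: "'a forest \<Rightarrow> 'a forest \<Rightarrow> 'a forest" where
  "stack [] g = []"
| "stack (t # f) g = graft t (take (size1 t) g) # stack f (drop (size1 t) g)"

definition skein_relations :: "('a tree \<times> 'a tree) set \<Rightarrow> bool" where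
  "skein_relations R \<longleftrightarrow> (\<forall>(t, s) \<in> R. size1 t = size1 s)"

inductive skein_eq :: "('a tree \<times> 'a tree) set \<Rightarrow> 'a forest \<Rightarrow> 'a forest \<Rightarrow> bool"
  for R :: "('a tree \<times> 'a tree) set" where
  base: "(t, s) \<in> R \<Longrightarrow> skein_eq R [t] [s]"
| refl: "skein_eq R f f"
| sym: "skein_eq R f g \<Longrightarrow> skein_eq R g f"
| trans: "skein_eq R f g \<Longrightarrow> skein_eq R g h \<Longrightarrow> skein_eq R f h"
| comp_right: "skein_eq R f f' \<Longrightarrow> leaves f = length g \<Longrightarrow> skein_eq R (stack f g) (stack f' g)"
| comp_left: "skein_eq R g g' \<Longrightarrow> leaves f = length g \<Longrightarrow> skein_eq R (stack f g) (stack f g')"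
| tensor_right: "skein_eq R f f' \<Longrightarrow> skein_eq R (f @ g) (f' @ g)"
| tensor_left: "skein_eq R g g' \<Longrightarrow> skein_eq R (f @ g) (f @ g')"


section \<open>Small categories, the Ore property and fraction groups\<close>

text \<open>
  Composition is written in diagrammatic order: \<open>cmp C f g\<close> is meaningful if
  \<^prop>\<open>tgt C f = src C g\<close>.
\<close>

record ('o, 'm) cat =
  arr :: "'m set"
  src :: "'m \<Rightarrow> 'o"
  tgt :: "'m \<Rightarrow> 'o"
  cmp :: "'m \<Rightarrow> 'm \<Rightarrow> 'm"
  idn :: "'o \<Rightarrow> 'm"

definition left_cancellative :: "('o, 'm) cat \<Rightarrow> bool" where
  "left_cancellative C \<longleftrightarrow>
    (\<forall>f \<in> arr C. \<forall>g \<in> arr C. \<forall>h \<in> arr C.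
      tgt C f = src C g \<longrightarrow> tgt C f = src C h \<longrightarrow> cmp C f g = cmp C f h \<longrightarrow> g = h)"

definition ore_category :: "('o, 'm) cat \<Rightarrow> bool" where
  "ore_category C \<longleftrightarrow> left_cancellative C \<and>
    (\<forall>f \<in> arr C. \<forall>g \<in> arr C. src C f = src C g \<longrightarrow>
      (\<exists>p \<in> arr C. \<exists>q \<in> arr C. tgt C f = src C p \<and> tgt C g = src C q \<and> cmp C f p = cmp C g q))"

definition frac_pairs :: "('o, 'm) cat \<Rightarrow> 'o \<Rightarrow> ('m \<times> 'm) set" where
  "frac_pairs C x =
    {(t, s). t \<in> arr C \<and> s \<in> arr C \<and> src C t = x \<and> src C s = x \<and> tgt C t = tgt C s}"

inductive frac_step :: "('o, 'm) cat \<Rightarrow> 'o \<Rightarrow> 'm \<times> 'm \<Rightarrow> 'm \<times> 'm \<Rightarrow> bool"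
  for C :: "('o, 'm) cat" and x :: 'o where
  "(t, s) \<in> frac_pairs C x \<Longrightarrow> f \<in> arr C \<Longrightarrow> src C f = tgt C t \<Longrightarrow>
    frac_step C x (t, s) (cmp C t f, cmp C s f)"

definition frac_class :: "('o, 'm) cat \<Rightarrow> 'o \<Rightarrow> 'm \<Rightarrow> 'm \<Rightarrow> ('m \<times> 'm) set" where
  "frac_class C x t s = {p. equivclp (frac_step C x) (t, s) p}"

text \<open>
  The product of two classes is the union of the classes \<open>[tp, s'p']\<close> over all representatives and all
  \<open>p, p'\<close> with \<open>sp = t'p'\<close>; these coincide in an Ore category.
\<close>

definition Frac :: "('o, 'm) cat \<Rightarrow> 'o \<Rightarrow> ('m \<times> 'm) set monoid" where
  "Frac C x =
    \<lparr>carrier = {frac_class C x t s | t s. (t, s) \<in> frac_pairs C x},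
     mult = (\<lambda>X Y. \<Union> {frac_class C x (cmp C t p) (cmp C s' p') | t s t' s' p p'.
        (t, s) \<in> X \<and> (t', s') \<in> Y \<and> p \<in> arr C \<and> p' \<in> arr C \<and>
        tgt C s = src C p \<and> tgt C t' = src C p' \<and> cmp C s p = cmp C t' p'}),
     one = frac_class C x (idn C x) (idn C x)\<rparr>"

text \<open>The group of right fractions of a monoid is the fraction group of the one-object category.\<close>

definition monoid_cat :: "'m monoid \<Rightarrow> (unit, 'm) cat" where
  "monoid_cat M =
    \<lparr>arr = carrier M, src = (\<lambda>_. ()), tgt = (\<lambda>_. ()), cmp = mult M, idn = (\<lambda>_. one M)\<rparr>"

definition Frac_monoid :: "'m monoid \<Rightarrow> ('m \<times> 'm) set monoid" where
  "Frac_monoid M = Frac (monoid_cat M) ()"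


section \<open>Forest-skein categories\<close>

definition skein_class :: "('a tree \<times> 'a tree) set \<Rightarrow> 'a forest \<Rightarrow> 'a forest set" where
  "skein_class R f = {g. skein_eq R f g}"

definition skein_roots :: "'a forest set \<Rightarrow> nat" where
  "skein_roots X = (THE n. length ` X = {n})"

definition skein_leaves :: "'a forest set \<Rightarrow> nat" where
  "skein_leaves X = (THE n. leaves ` X = {n})"

text \<open>
  Operations on classes are unions over representatives; since \<^const>\<open>skein_eq\<close> is a congruence,
  these unions consist of a single class.
\<close>

definition skein_comp ::
    "('a tree \<times> 'a tree) set \<Rightarrow> 'a forest set \<Rightarrow> 'a forest set \<Rightarrow> 'a forest set" where
  "skein_comp R X Y =
    \<Union> {skein_class R (stack f g) | f g. f \<in> X \<and> g \<in> Y \<and> leaves f = length g}"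

definition skein_tensor ::
    "('a tree \<times> 'a tree) set \<Rightarrow> 'a forest set \<Rightarrow> 'a forest set \<Rightarrow> 'a forest set" where
  "skein_tensor R X Y = \<Union> {skein_class R (f @ g) | f g. f \<in> X \<and> g \<in> Y}"

text \<open>
  The objects of \<open>ForC\<langle>S | R\<rangle>\<close> are the natural numbers; a forest is an arrow from its number of roots to
  its number of leaves.
\<close>

definition ForC :: "('a tree \<times> 'a tree) set \<Rightarrow> (nat, 'a forest set) cat" where
  "ForC R =
    \<lparr>arr = range (skein_class R), src = skein_roots, tgt = skein_leaves, cmp = skein_comp R,
     idn = (\<lambda>n. skein_class R (replicate n Leaf))\<rparr>"

definition skein_trees :: "('a tree \<times> 'a tree) set \<Rightarrow> 'a forest set set" where
  "skein_trees R = {X \<in> arr (ForC R). src (ForC R) X = 1}"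

definition trivial_tree :: "('a tree \<times> 'a tree) set \<Rightarrow> 'a forest set" where
  "trivial_tree R = skein_class R [Leaf]"

definition skein_tensor_list :: "('a tree \<times> 'a tree) set \<Rightarrow> 'a forest set list \<Rightarrow> 'a forest set" where
  "skein_tensor_list R Xs = foldr (skein_tensor R) Xs (skein_class R [])"

text \<open>
  Sequences are indexed from \<open>0\<close>. The leaves of \<open>\<phi> n\<close> are those of the sequence \<open>\<phi>\<close> with positions from
  \<open>leaf_offset \<phi> n\<close> up to (excluding) \<open>leaf_offset \<phi> (Suc n)\<close>.
\<close>

definition leaf_offset :: "(nat \<Rightarrow> 'a forest set) \<Rightarrow> nat \<Rightarrow> nat" where
  "leaf_offset \<phi> n = (\<Sum>i<n. skein_leaves (\<phi> i))"

definition F_infinity :: "('a tree \<times> 'a tree) set \<Rightarrow> (nat \<Rightarrow> 'a forest set) monoid" where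
  "F_infinity R =
    \<lparr>carrier = {\<phi>. (\<forall>n. \<phi> n \<in> skein_trees R) \<and> finite {n. \<phi> n \<noteq> trivial_tree R}},
     mult = (\<lambda>\<phi> \<psi> n. skein_comp R (\<phi> n)
        (skein_tensor_list R (map \<psi> [leaf_offset \<phi> n ..< leaf_offset \<phi> (Suc n)]))),
     one = (\<lambda>_. trivial_tree R)\<rparr>"


section \<open>Group properties closed under subgroups\<close>

text \<open>
  A property of groups is an isomorphism-invariant predicate; it is given here on the groups whose
  elements live in a type \<open>'x\<close>, which is arbitrary.
\<close>

definition subgroup_closed_property :: "('x monoid \<Rightarrow> bool) \<Rightarrow> bool" where
  "subgroup_closed_property P \<longleftrightarrow>
    (\<forall>K L. group K \<longrightarrow> group L \<longrightarrow> K \<cong> L \<longrightarrow> P K \<longrightarrow> P L) \<and>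
    (\<forall>K A. group K \<longrightarrow> subgroup A K \<longrightarrow> P K \<longrightarrow> P (K\<lparr>carrier := A\<rparr>))"

end

theory Submission
  imports Defs "HOL-Algebra.Coset"
begin

text \<open>
  Both groups consist of fractions of forests, and both embeddings come from turning a pair of forests of one
  kind into a pair of the other kind. Three facts make this work.

  In an Ore category two fractions agree if they have a common expansion, and \<open>[t, s] = 1\<close> if and only if
  \<open>tf = sf\<close> for some \<open>f\<close>. Hence a map on pairs \<open>(t, s)\<close> that is invariant under expansion, is multiplicative on
  pairs with matching inner entries, and is trivial only on pairs equalised by some arrow induces an injective
  morphism of the fraction group (lemma \<open>Frac_embedding\<close>).

  The skein relations only identify trees that have the same number of leaves, and forests are equivalent
  if and only if they are so tree by tree (lemma \<open>skein_eq_treewise\<close>). Therefore the monoid \<open>\<F>\<^sub>\<infinity>\<close> is the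
  union of the sets of classes of forests with \<open>n\<close> roots along \<open>f \<mapsto> f \<otimes> I\<close>, with stacking as product (lemma
  \<open>seq_of_mult\<close>). It inherits left cancellation and common right-multiples from the category of forests.

  For \<open>\<eta>\<^sub>k\<close> a pair of trees is placed at the \<open>k\<close>-th root of a trivial sequence; a sequence that equalises the
  two placements contains a forest that equalises the two trees. For \<open>\<gamma>\<^sub>a\<close> the first \<open>n\<close> entries of a sequence
  are attached to a right vine with \<open>n\<close> vertices of colour \<open>a\<close>, the last leaf of the vine standing for the
  infinite trivial tail. Taking one more entry adds a vertex at the last leaf of the vine, so for two sequences
  whose vines have the same number of leaves this expands numerator and denominator simultaneously and the
  fraction does not change. Injectivity holds because a vine determines the forest that it carries, up to the
  skein relations, even if the number of its vertices is not prescribed (lemma \<open>vine_inj\<close>): a longer vine would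
  have too many leaves.
\<close>

section \<open>Fractions in Ore categories\<close>

text \<open>
  The records \<^typ>\<open>('o, 'm) cat\<close> carry no axioms, so the category laws are collected here together with
  the Ore property. Two instances matter: the forest-skein category itself, and the monoid
  \<open>\<F>\<^sub>\<infinity>\<close> seen as a category with one object.
\<close>

locale ore_cat =
  fixes C :: "('o, 'm) cat"
  assumes cmp_arr: "\<lbrakk>f \<in> arr C; g \<in> arr C; tgt C f = src C g\<rbrakk> \<Longrightarrow> cmp C f g \<in> arr C"
    and src_cmp: "\<lbrakk>f \<in> arr C; g \<in> arr C; tgt C f = src C g\<rbrakk> \<Longrightarrow> src C (cmp C f g) = src C f"
    and tgt_cmp: "\<lbrakk>f \<in> arr C; g \<in> arr C; tgt C f = src C g\<rbrakk> \<Longrightarrow> tgt C (cmp C f g) = tgt C g"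
    and cmp_assoc: "\<lbrakk>f \<in> arr C; g \<in> arr C; h \<in> arr C; tgt C f = src C g; tgt C g = src C h\<rbrakk> \<Longrightarrow>
      cmp C (cmp C f g) h = cmp C f (cmp C g h)"
    and idn_arr: "idn C x \<in> arr C"
    and src_idn: "src C (idn C x) = x"
    and tgt_idn: "tgt C (idn C x) = x"
    and cmp_idn_left: "f \<in> arr C \<Longrightarrow> cmp C (idn C (src C f)) f = f"
    and cmp_idn_right: "f \<in> arr C \<Longrightarrow> cmp C f (idn C (tgt C f)) = f"
    and ore: "ore_category C"
begin

definition Hom :: "'o \<Rightarrow> 'o \<Rightarrow> 'm set" where
  "Hom x y = {f \<in> arr C. src C f = x \<and> tgt C f = y}"

abbreviation comp_notation :: "'m \<Rightarrow> 'm \<Rightarrow> 'm" (infixr "\<cdot>" 70) where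
  "f \<cdot> g \<equiv> cmp C f g"

lemma cmp_Hom [intro]: "f \<in> Hom x y \<Longrightarrow> g \<in> Hom y z \<Longrightarrow> f \<cdot> g \<in> Hom x z"
  by (auto simp: Hom_def cmp_arr src_cmp tgt_cmp)

lemma idn_Hom [intro]: "idn C x \<in> Hom x x"
  by (simp add: Hom_def idn_arr src_idn tgt_idn)

lemma assoc_Hom: "f \<in> Hom x y \<Longrightarrow> g \<in> Hom y z \<Longrightarrow> h \<in> Hom z w \<Longrightarrow> (f \<cdot> g) \<cdot> h = f \<cdot> g \<cdot> h"
  by (auto simp: Hom_def cmp_assoc)

lemma idn_left_Hom: "f \<in> Hom x y \<Longrightarrow> idn C x \<cdot> f = f"
  and idn_right_Hom: "f \<in> Hom x y \<Longrightarrow> f \<cdot> idn C y = f"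
  using cmp_idn_left cmp_idn_right by (auto simp: Hom_def)

lemma cancel_Hom:
  assumes "f \<in> Hom x y" "g \<in> Hom y z" "h \<in> Hom y w" "f \<cdot> g = f \<cdot> h"
  shows "g = h"
proof -
  have "f \<in> arr C" "g \<in> arr C" "h \<in> arr C" "tgt C f = src C g" "tgt C f = src C h"
    using assms by (simp_all add: Hom_def)
  with assms(4) ore show ?thesis
    unfolding ore_category_def left_cancellative_def by metis
qed

lemma ore_Hom:
  assumes "f \<in> Hom x y" "g \<in> Hom x z"
  obtains w p q where "p \<in> Hom y w" "q \<in> Hom z w" "f \<cdot> p = g \<cdot> q"
proof -
  obtain p q where pq: "p \<in> arr C" "q \<in> arr C" "tgt C f = src C p" "tgt C g = src C q" "f \<cdot> p = g \<cdot> q"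
  proof -
    have "f \<in> arr C" "g \<in> arr C" "src C f = src C g"
      using assms by (auto simp: Hom_def)
    with ore have "\<exists>p \<in> arr C. \<exists>q \<in> arr C. tgt C f = src C p \<and> tgt C g = src C q \<and> f \<cdot> p = g \<cdot> q"
      unfolding ore_category_def by blast
    with that show thesis by blast
  qed
  have fg: "f \<in> arr C" "g \<in> arr C" "tgt C f = y" "tgt C g = z"
    using assms by (simp_all add: Hom_def)
  have "tgt C p = tgt C q"
    using tgt_cmp[OF fg(1) pq(1,3)] tgt_cmp[OF fg(2) pq(2,4)] pq(5) by metis
  then have "p \<in> Hom y (tgt C p)" "q \<in> Hom z (tgt C p)"
    using pq(1-4) fg(3,4) by (simp_all add: Hom_def)
  then show thesis
    using that pq(5) by blast
qed

lemma eq_extend: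
  assumes "f \<cdot> p = g \<cdot> q" "f \<in> Hom x y" "p \<in> Hom y w" "g \<in> Hom x z" "q \<in> Hom z w" "r \<in> Hom w v"
  shows "f \<cdot> p \<cdot> r = g \<cdot> q \<cdot> r"
  using assoc_Hom[OF assms(2,3,6)] assoc_Hom[OF assms(4,5,6)] assms(1) by simp

lemma frac_pairs_iff: "(t, s) \<in> frac_pairs C x \<longleftrightarrow> (\<exists>y. t \<in> Hom x y \<and> s \<in> Hom x y)"
  by (auto simp: frac_pairs_def Hom_def)

text \<open>
  Two fractions are related if they have a common expansion. This is the relation generated by
  \<^const>\<open>frac_step\<close>, in a form that exposes a witness: the Ore property makes it transitive, so a zigzag of
  steps collapses to a single common expansion.
\<close>

inductive frac_rel :: "'o \<Rightarrow> 'm \<times> 'm \<Rightarrow> 'm \<times> 'm \<Rightarrow> bool" for x where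
  frac_relI: "t \<in> Hom x y \<Longrightarrow> s \<in> Hom x y \<Longrightarrow> t' \<in> Hom x z \<Longrightarrow> s' \<in> Hom x z \<Longrightarrow>
    f \<in> Hom y w \<Longrightarrow> f' \<in> Hom z w \<Longrightarrow> t \<cdot> f = t' \<cdot> f' \<Longrightarrow> s \<cdot> f = s' \<cdot> f' \<Longrightarrow>
    frac_rel x (t, s) (t', s')"

lemma frac_rel_refl: "t \<in> Hom x y \<Longrightarrow> s \<in> Hom x y \<Longrightarrow> frac_rel x (t, s) (t, s)"
  using frac_relI idn_Hom by blast

lemma frac_rel_sym: "frac_rel x p q \<Longrightarrow> frac_rel x q p"
  by (erule frac_rel.cases) (auto intro!: frac_relI dest: HOL.sym)

lemma frac_rel_trans:
  assumes "frac_rel x p q" "frac_rel x q r"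
  shows "frac_rel x p r"
  using assms(1)
proof cases
  case 1: (frac_relI t y s t' z s' f w f')
  show ?thesis
    using assms(2)
  proof cases
    case 2: (frac_relI u y1 v u' z1 v' g w1 g')
    have eq: "u = t'" "v = s'" "y1 = z"
      using 1 2 by (auto simp: Hom_def)
    have "f' \<in> Hom z w" "g \<in> Hom z w1"
      using 1 2 eq by auto
    then obtain d k l where kl: "k \<in> Hom w d" "l \<in> Hom w1 d" "f' \<cdot> k = g \<cdot> l"
      by (rule ore_Hom)
    have "t \<cdot> f \<cdot> k = t' \<cdot> f' \<cdot> k" "s \<cdot> f \<cdot> k = s' \<cdot> f' \<cdot> k"
      using eq_extend[OF 1(9,3,7,5,8) kl(1)] eq_extend[OF 1(10,4,7,6,8) kl(1)] by simp_all
    moreover have "t' \<cdot> g \<cdot> l = u' \<cdot> g' \<cdot> l" "s' \<cdot> g \<cdot> l = v' \<cdot> g' \<cdot> l"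
      using eq_extend[OF 2(9,3,7,5,8) kl(2)] eq_extend[OF 2(10,4,7,6,8) kl(2)] eq by simp_all
    ultimately show ?thesis
      unfolding 1 2 using 1 2 kl by (intro frac_relI[where f = "f \<cdot> k" and f' = "g' \<cdot> l"]) auto
  qed
qed

lemma frac_rel_Hom:
  assumes "frac_rel x p (t, s)"
  obtains z where "t \<in> Hom x z" "s \<in> Hom x z"
  using assms by cases

lemma frac_step_rel: "frac_step C x p q \<Longrightarrow> frac_rel x p q"
proof (erule frac_step.cases)
  fix t s f
  assume *: "p = (t, s)" "q = (t \<cdot> f, s \<cdot> f)" "(t, s) \<in> frac_pairs C x" "f \<in> arr C" "src C f = tgt C t"
  then obtain y where y: "t \<in> Hom x y" "s \<in> Hom x y" "f \<in> Hom y (tgt C f)"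
    by (auto simp: frac_pairs_iff Hom_def)
  show "frac_rel x p q"
    unfolding * using y idn_right_Hom[OF cmp_Hom[OF y(1,3)]] idn_right_Hom[OF cmp_Hom[OF y(2,3)]]
    by (intro frac_relI[where f = f and f' = "idn C (tgt C f)"]) auto
qed

lemma equivclp_frac_step_iff:
  assumes "p \<in> frac_pairs C x"
  shows "equivclp (frac_step C x) p q \<longleftrightarrow> frac_rel x p q"
proof
  assume "equivclp (frac_step C x) p q"
  then show "frac_rel x p q"
  proof (induction rule: equivclp_induct)
    case base
    then show ?case
      using assms by (cases p) (auto simp: frac_pairs_iff intro: frac_rel_refl)
  next
    case (step q r)
    then show ?case
      using frac_step_rel frac_rel_sym frac_rel_trans by blast
  qed
next
  assume "frac_rel x p q"
  then show "equivclp (frac_step C x) p q"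
  proof cases
    case (frac_relI t y s t' z s' f w f')
    have "frac_step C x p (t \<cdot> f, s \<cdot> f)" "frac_step C x q (t' \<cdot> f', s' \<cdot> f')"
      unfolding frac_relI(1,2) by (rule frac_step.intros; use frac_relI in \<open>auto simp: frac_pairs_iff Hom_def\<close>)+
    then show ?thesis
      using frac_relI by (metis equivclp_sym equivclp_trans r_into_equivclp)
  qed
qed

lemma mem_frac_class:
  assumes "t \<in> Hom x y" "s \<in> Hom x y"
  shows "q \<in> frac_class C x t s \<longleftrightarrow> frac_rel x (t, s) q"
  using assms equivclp_frac_step_iff[of "(t, s)" x q] by (auto simp: frac_class_def frac_pairs_iff)

lemma frac_class_eq_iff:
  assumes "t \<in> Hom x y" "s \<in> Hom x y" "t' \<in> Hom x z" "s' \<in> Hom x z"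
  shows "frac_class C x t s = frac_class C x t' s' \<longleftrightarrow> frac_rel x (t, s) (t', s')"
proof
  assume "frac_class C x t s = frac_class C x t' s'"
  then show "frac_rel x (t, s) (t', s')"
    using mem_frac_class[OF assms(1,2)] mem_frac_class[OF assms(3,4)] frac_rel_refl[OF assms(3,4)] by blast
next
  assume "frac_rel x (t, s) (t', s')"
  then have "q \<in> frac_class C x t s \<longleftrightarrow> q \<in> frac_class C x t' s'" for q
    using mem_frac_class[OF assms(1,2)] mem_frac_class[OF assms(3,4)] frac_rel_sym frac_rel_trans by blast
  then show "frac_class C x t s = frac_class C x t' s'"
    by blast
qed

lemma frac_class_cmp:
  assumes "t \<in> Hom x y" "s \<in> Hom x y" "f \<in> Hom y z"
  shows "frac_class C x (t \<cdot> f) (s \<cdot> f) = frac_class C x t s"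
proof -
  have "t \<cdot> f \<in> Hom x z" "s \<cdot> f \<in> Hom x z"
    using assms by auto
  moreover have "frac_rel x (t \<cdot> f, s \<cdot> f) (t, s)"
    using assms by (intro frac_relI[where f = "idn C z" and f' = f]) (auto intro: idn_right_Hom)
  ultimately show ?thesis
    using frac_class_eq_iff assms by blast
qed

lemma carrier_Frac: "carrier (Frac C x) = {frac_class C x t s | t s y. t \<in> Hom x y \<and> s \<in> Hom x y}"
  unfolding Frac_def by (auto simp: frac_pairs_iff)

lemma frac_class_in_carrier [intro]: "t \<in> Hom x y \<Longrightarrow> s \<in> Hom x y \<Longrightarrow> frac_class C x t s \<in> carrier (Frac C x)"
  unfolding carrier_Frac by blast

lemma one_Frac: "\<one>\<^bsub>Frac C x\<^esub> = frac_class C x (idn C x) (idn C x)"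
  by (simp add: Frac_def)

lemma frac_class_diag:
  assumes "t \<in> Hom x y"
  shows "frac_class C x t t = \<one>\<^bsub>Frac C x\<^esub>"
  using frac_class_cmp[OF idn_Hom idn_Hom assms] assms by (simp add: one_Frac idn_left_Hom)

text \<open>
  If \<open>[t, s]\<close> and \<open>[1, 1]\<close> have a common expansion \<open>tf = f'\<close>, \<open>sf = f'\<close>, then \<open>f\<close> equalises \<open>t\<close> and \<open>s\<close>.
  Fractions of sequences and fractions of trees are compared through this criterion, which speaks of
  compositions only.
\<close>

lemma frac_class_one_iff:
  assumes "t \<in> Hom x y" "s \<in> Hom x y"
  shows "frac_class C x t s = \<one>\<^bsub>Frac C x\<^esub> \<longleftrightarrow> (\<exists>z. \<exists>f\<in>Hom y z. t \<cdot> f = s \<cdot> f)"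
proof
  assume "frac_class C x t s = \<one>\<^bsub>Frac C x\<^esub>"
  then have "frac_rel x (t, s) (idn C x, idn C x)"
    using frac_class_eq_iff[OF assms idn_Hom idn_Hom] by (simp add: one_Frac)
  then show "\<exists>z. \<exists>f\<in>Hom y z. t \<cdot> f = s \<cdot> f"
  proof cases
    case (frac_relI y' z f w f')
    have "y' = y" "z = x"
      using assms frac_relI idn_Hom by (auto simp: Hom_def)
    then show ?thesis
      using frac_relI by metis
  qed
next
  assume "\<exists>z. \<exists>f\<in>Hom y z. t \<cdot> f = s \<cdot> f"
  then obtain z f where f: "f \<in> Hom y z" "t \<cdot> f = s \<cdot> f"
    by blast
  show "frac_class C x t s = \<one>\<^bsub>Frac C x\<^esub>"
    using frac_class_cmp[OF assms f(1)] frac_class_diag[OF cmp_Hom[OF assms(2) f(1)]] f(2) by simp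
qed

text \<open>
  The product of two fractions depends neither on the representatives nor on the chosen common multiple.
  The Ore property is used three times: to make \<open>p\<close> agree with the expansion \<open>f\<close> of the first fraction, to
  make the result agree with \<open>q\<close>, and to bring in the expansion \<open>g\<close> of the second fraction. What remains is
  an equation after \<open>t1'\<close>, which left cancellation removes.
\<close>

lemma frac_mult_unique:
  assumes ts: "frac_rel x (t, s) (t1, s1)" and ts': "frac_rel x (t', s') (t1', s1')"
    and p: "p \<in> Hom y a" "p' \<in> Hom y' a" "s \<in> Hom x y" "t' \<in> Hom x y'" "s \<cdot> p = t' \<cdot> p'"
    and q: "q \<in> Hom z b" "q' \<in> Hom z' b" "s1 \<in> Hom x z" "t1' \<in> Hom x z'" "s1 \<cdot> q = t1' \<cdot> q'"
  shows "frac_rel x (t \<cdot> p, s' \<cdot> p') (t1 \<cdot> q, s1' \<cdot> q')"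
proof -
  obtain w f f1 where f: "f \<in> Hom y w" "f1 \<in> Hom z w" "t \<cdot> f = t1 \<cdot> f1" "s \<cdot> f = s1 \<cdot> f1"
      and t: "t \<in> Hom x y" "t1 \<in> Hom x z"
    using ts p q by (elim frac_rel.cases) (auto simp: Hom_def)
  obtain w' g g1 where g: "g \<in> Hom y' w'" "g1 \<in> Hom z' w'" "t' \<cdot> g = t1' \<cdot> g1" "s' \<cdot> g = s1' \<cdot> g1"
      and s': "s' \<in> Hom x y'" "s1' \<in> Hom x z'"
    using ts' p q by (elim frac_rel.cases) (auto simp: Hom_def)
  obtain c u v where uv: "u \<in> Hom a c" "v \<in> Hom w c" "p \<cdot> u = f \<cdot> v"
    using ore_Hom p f by metis
  obtain d k l where kl: "k \<in> Hom c d" "l \<in> Hom b d" "(f1 \<cdot> v) \<cdot> k = q \<cdot> l"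
    by (rule ore_Hom[OF cmp_Hom[OF f(2) uv(2)] q(1)])
  have uk: "u \<cdot> k \<in> Hom a d" "v \<cdot> k \<in> Hom w d"
    using uv kl by auto
  have puk: "p \<cdot> u \<cdot> k = f \<cdot> v \<cdot> k" and qk: "f1 \<cdot> v \<cdot> k = q \<cdot> l"
    using eq_extend[OF uv(3)] p uv f kl assoc_Hom[OF f(2) uv(2) kl(1)] by auto
  have 1: "t \<cdot> p \<cdot> u \<cdot> k = t1 \<cdot> q \<cdot> l"
    using eq_extend[OF f(3) t(1) f(1) t(2) f(2) uk(2)] puk qk by simp
  have "s \<cdot> p \<cdot> u \<cdot> k = s1 \<cdot> q \<cdot> l"
    using eq_extend[OF f(4) p(3) f(1) q(3) f(2) uk(2)] puk qk by simp
  then have 2: "t' \<cdot> p' \<cdot> u \<cdot> k = t1' \<cdot> q' \<cdot> l"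
    using eq_extend[OF p(5,3,1,4,2) uk(1)] eq_extend[OF q(5,3,1,4,2) kl(2)] by simp
  obtain e m n where mn: "m \<in> Hom d e" "n \<in> Hom w' e" "(p' \<cdot> u \<cdot> k) \<cdot> m = g \<cdot> n"
    by (rule ore_Hom[OF cmp_Hom[OF p(2) uk(1)] g(1)])
  have ukm: "(u \<cdot> k) \<cdot> m \<in> Hom a e" "l \<cdot> m \<in> Hom b e"
    using uk kl mn by auto
  have 3: "p' \<cdot> (u \<cdot> k) \<cdot> m = g \<cdot> n"
    using mn assoc_Hom[OF p(2) uk(1) mn(1)] by simp
  have "t1' \<cdot> q' \<cdot> l \<cdot> m = t' \<cdot> p' \<cdot> (u \<cdot> k) \<cdot> m"
    using eq_extend[OF 2 p(4) cmp_Hom[OF p(2) uk(1)] q(4) cmp_Hom[OF q(2) kl(2)] mn(1)]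
      assoc_Hom[OF p(2) uk(1) mn(1)] assoc_Hom[OF q(2) kl(2) mn(1)] by simp
  also have "\<dots> = t1' \<cdot> g1 \<cdot> n"
    using eq_extend[OF g(3) p(4) g(1) q(4) g(2) mn(2)] 3 by simp
  finally have 4: "q' \<cdot> l \<cdot> m = g1 \<cdot> n"
    by (rule cancel_Hom[OF q(4) cmp_Hom[OF q(2) ukm(2)] cmp_Hom[OF g(2) mn(2)]])
  have 5: "s' \<cdot> p' \<cdot> (u \<cdot> k) \<cdot> m = s1' \<cdot> q' \<cdot> l \<cdot> m"
    using eq_extend[OF g(4) s'(1) g(1) s'(2) g(2) mn(2)] 3 4 by simp
  have 6: "t \<cdot> p \<cdot> (u \<cdot> k) \<cdot> m = t1 \<cdot> q \<cdot> l \<cdot> m"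
    using eq_extend[OF 1 t(1) cmp_Hom[OF p(1) uk(1)] t(2) cmp_Hom[OF q(1) kl(2)] mn(1)]
      assoc_Hom[OF p(1) uk(1) mn(1)] assoc_Hom[OF q(1) kl(2) mn(1)] by simp
  show ?thesis
    using 5 6 assoc_Hom[OF t(1) p(1) ukm(1)] assoc_Hom[OF t(2) q(1) ukm(2)]
      assoc_Hom[OF s'(1) p(2) ukm(1)] assoc_Hom[OF s'(2) q(2) ukm(2)]
    by (intro frac_relI[OF cmp_Hom[OF t(1) p(1)] cmp_Hom[OF s'(1) p(2)] cmp_Hom[OF t(2) q(1)]
          cmp_Hom[OF s'(2) q(2)] ukm]) simp_all
qed

lemma mult_Frac:
  assumes ts: "t \<in> Hom x y" "s \<in> Hom x y" and ts': "t' \<in> Hom x y'" "s' \<in> Hom x y'"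
    and p: "p \<in> Hom y a" "p' \<in> Hom y' a" "s \<cdot> p = t' \<cdot> p'"
  shows "frac_class C x t s \<otimes>\<^bsub>Frac C x\<^esub> frac_class C x t' s' = frac_class C x (t \<cdot> p) (s' \<cdot> p')"
proof -
  \<comment> \<open>The product is a union of classes; all of them turn out to be the same class.\<close>
  have unique: "frac_class C x (t1 \<cdot> q) (s1' \<cdot> q') = frac_class C x (t \<cdot> p) (s' \<cdot> p')"
    if 1: "(t1, s1) \<in> frac_class C x t s" "(t1', s1') \<in> frac_class C x t' s'"
      and q: "q \<in> arr C" "q' \<in> arr C" "tgt C s1 = src C q" "tgt C t1' = src C q'" "s1 \<cdot> q = t1' \<cdot> q'"
    for t1 s1 t1' s1' q q'
  proof -
    have rel: "frac_rel x (t, s) (t1, s1)" "frac_rel x (t', s') (t1', s1')"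
      using 1 mem_frac_class[OF ts] mem_frac_class[OF ts'] by simp_all
    obtain z where z: "t1 \<in> Hom x z" "s1 \<in> Hom x z"
      by (rule frac_rel_Hom[OF rel(1)])
    obtain z' where z': "t1' \<in> Hom x z'" "s1' \<in> Hom x z'"
      by (rule frac_rel_Hom[OF rel(2)])
    have arr: "s1 \<in> arr C" "t1' \<in> arr C"
      using z z' by (simp_all add: Hom_def)
    have "tgt C q = tgt C q'"
      using tgt_cmp[OF arr(1) q(1,3)] tgt_cmp[OF arr(2) q(2,4)] unfolding q(5) by simp
    then have q': "q \<in> Hom z (tgt C q)" "q' \<in> Hom z' (tgt C q)"
      using q(1-4) z z' by (simp_all add: Hom_def)
    have "frac_rel x (t \<cdot> p, s' \<cdot> p') (t1 \<cdot> q, s1' \<cdot> q')"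
      using frac_mult_unique[OF rel p(1,2) ts(2) ts'(1) p(3) q' z(2) z'(1) q(5)] .
    then show ?thesis
      using frac_class_eq_iff[OF cmp_Hom[OF ts(1) p(1)] cmp_Hom[OF ts'(2) p(2)]
          cmp_Hom[OF z(1) q'(1)] cmp_Hom[OF z'(2) q'(2)]] by blast
  qed
  have "{frac_class C x (t1 \<cdot> q) (s1' \<cdot> q') | t1 s1 t1' s1' q q'.
        (t1, s1) \<in> frac_class C x t s \<and> (t1', s1') \<in> frac_class C x t' s' \<and> q \<in> arr C \<and> q' \<in> arr C \<and>
        tgt C s1 = src C q \<and> tgt C t1' = src C q' \<and> s1 \<cdot> q = t1' \<cdot> q'} =
        {frac_class C x (t \<cdot> p) (s' \<cdot> p')}" (is "?L = _")
  proof -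
    have "(t, s) \<in> frac_class C x t s" "(t', s') \<in> frac_class C x t' s'"
      using mem_frac_class[OF ts] mem_frac_class[OF ts'] frac_rel_refl[OF ts] frac_rel_refl[OF ts'] by simp_all
    moreover have "p \<in> arr C" "p' \<in> arr C" "tgt C s = src C p" "tgt C t' = src C p'"
      using ts ts' p by (simp_all add: Hom_def)
    ultimately have "frac_class C x (t \<cdot> p) (s' \<cdot> p') \<in> ?L"
      using p(3) by blast
    moreover have "?L \<subseteq> {frac_class C x (t \<cdot> p) (s' \<cdot> p')}"
      using unique by blast
    ultimately show ?thesis
      by blast
  qed
  then show ?thesis
    unfolding Frac_def by simp
qed

text \<open>
  Fractions with matching inner entries multiply by cancelling them. Since finitely many fractions can be
  expanded until their inner entries match, the group axioms and the homomorphism property below reduce to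
  this formula.
\<close>

lemma mult_Frac_middle:
  assumes "t \<in> Hom x y" "s \<in> Hom x y" "u \<in> Hom x y"
  shows "frac_class C x t s \<otimes>\<^bsub>Frac C x\<^esub> frac_class C x s u = frac_class C x t u"
  using mult_Frac[OF assms(1,2) assms(2,3) idn_Hom idn_Hom HOL.refl] idn_right_Hom[OF assms(1)]
    idn_right_Hom[OF assms(3)] by simp

lemma frac_common_middle:
  assumes "X \<in> carrier (Frac C x)" "Y \<in> carrier (Frac C x)"
  obtains y t s u where "t \<in> Hom x y" "s \<in> Hom x y" "u \<in> Hom x y"
    "X = frac_class C x t s" "Y = frac_class C x s u"
proof -
  obtain t s y where 1: "t \<in> Hom x y" "s \<in> Hom x y" "X = frac_class C x t s"
    using assms(1) unfolding carrier_Frac by blast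
  obtain t' s' y' where 2: "t' \<in> Hom x y'" "s' \<in> Hom x y'" "Y = frac_class C x t' s'"
    using assms(2) unfolding carrier_Frac by blast
  obtain w p q where pq: "p \<in> Hom y w" "q \<in> Hom y' w" "s \<cdot> p = t' \<cdot> q"
    by (rule ore_Hom[OF 1(2) 2(1)])
  show thesis
    using frac_class_cmp[OF 1(1,2) pq(1)] frac_class_cmp[OF 2(1,2) pq(2)] 1(3) 2(3) pq(3)
    by (intro that[OF cmp_Hom[OF 1(1) pq(1)] cmp_Hom[OF 1(2) pq(1)] cmp_Hom[OF 2(2) pq(2)]]) simp_all
qed

lemma frac_common_middle_three:
  assumes "X \<in> carrier (Frac C x)" "Y \<in> carrier (Frac C x)" "Z \<in> carrier (Frac C x)"
  obtains y t s u v where "t \<in> Hom x y" "s \<in> Hom x y" "u \<in> Hom x y" "v \<in> Hom x y"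
    "X = frac_class C x t s" "Y = frac_class C x s u" "Z = frac_class C x u v"
proof -
  obtain y t s u where 1: "t \<in> Hom x y" "s \<in> Hom x y" "u \<in> Hom x y"
    "X = frac_class C x t s" "Y = frac_class C x s u"
    by (rule frac_common_middle[OF assms(1,2)])
  obtain t' s' y' where 2: "t' \<in> Hom x y'" "s' \<in> Hom x y'" "Z = frac_class C x t' s'"
    using assms(3) unfolding carrier_Frac by blast
  obtain w p q where pq: "p \<in> Hom y w" "q \<in> Hom y' w" "u \<cdot> p = t' \<cdot> q"
    by (rule ore_Hom[OF 1(3) 2(1)])
  show thesis
    using frac_class_cmp[OF 1(1,2) pq(1)] frac_class_cmp[OF 1(2,3) pq(1)]
      frac_class_cmp[OF 2(1,2) pq(2)] 1(4,5) 2(3) pq(3)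
    by (intro that[OF cmp_Hom[OF 1(1) pq(1)] cmp_Hom[OF 1(2) pq(1)] cmp_Hom[OF 1(3) pq(1)]
          cmp_Hom[OF 2(2) pq(2)]]) simp_all
qed

lemma group_Frac: "group (Frac C x)"
proof (rule groupI)
  show "\<one>\<^bsub>Frac C x\<^esub> \<in> carrier (Frac C x)"
    unfolding one_Frac by (intro frac_class_in_carrier) auto
next
  fix X Y assume "X \<in> carrier (Frac C x)" "Y \<in> carrier (Frac C x)"
  then show "X \<otimes>\<^bsub>Frac C x\<^esub> Y \<in> carrier (Frac C x)"
    by (rule frac_common_middle) (auto simp: mult_Frac_middle)
next
  fix X Y Z assume "X \<in> carrier (Frac C x)" "Y \<in> carrier (Frac C x)" "Z \<in> carrier (Frac C x)"
  then show "X \<otimes>\<^bsub>Frac C x\<^esub> Y \<otimes>\<^bsub>Frac C x\<^esub> Z = X \<otimes>\<^bsub>Frac C x\<^esub> (Y \<otimes>\<^bsub>Frac C x\<^esub> Z)"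
    by (rule frac_common_middle_three) (auto simp: mult_Frac_middle)
next
  fix X assume "X \<in> carrier (Frac C x)"
  then obtain t s y where ts: "t \<in> Hom x y" "s \<in> Hom x y" "X = frac_class C x t s"
    unfolding carrier_Frac by blast
  show "\<one>\<^bsub>Frac C x\<^esub> \<otimes>\<^bsub>Frac C x\<^esub> X = X"
    using mult_Frac_middle[OF ts(1) ts(1) ts(2)] frac_class_diag[OF ts(1)] ts(3) by simp
  show "\<exists>Y\<in>carrier (Frac C x). Y \<otimes>\<^bsub>Frac C x\<^esub> X = \<one>\<^bsub>Frac C x\<^esub>"
    using mult_Frac_middle[OF ts(2) ts(1) ts(2)] frac_class_diag[OF ts(2)] ts by auto
qed

text \<open>
  An embedding of the fraction group amounts to a cocycle \<open>c\<close> on the pairs \<open>(t, s)\<close>: invariant under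
  expansion, multiplicative on matching pairs, and trivial only on pairs that some arrow equalises.
\<close>

lemma Frac_embedding:
  fixes K :: "('k, 'l) monoid_scheme"
  assumes K: "group K"
    and closed: "\<And>y t s. t \<in> Hom x y \<Longrightarrow> s \<in> Hom x y \<Longrightarrow> c t s \<in> carrier K"
    and step: "\<And>y z t s f. t \<in> Hom x y \<Longrightarrow> s \<in> Hom x y \<Longrightarrow> f \<in> Hom y z \<Longrightarrow> c (t \<cdot> f) (s \<cdot> f) = c t s"
    and mult: "\<And>y t s u. t \<in> Hom x y \<Longrightarrow> s \<in> Hom x y \<Longrightarrow> u \<in> Hom x y \<Longrightarrow> c t s \<otimes>\<^bsub>K\<^esub> c s u = c t u"
    and faithful: "\<And>y t s. t \<in> Hom x y \<Longrightarrow> s \<in> Hom x y \<Longrightarrow> c t s = \<one>\<^bsub>K\<^esub> \<Longrightarrow> \<exists>z. \<exists>f\<in>Hom y z. t \<cdot> f = s \<cdot> f"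
  shows "\<exists>h. group_hom (Frac C x) K h \<and> inj_on h (carrier (Frac C x)) \<and>
    (\<forall>y. \<forall>t \<in> Hom x y. \<forall>s \<in> Hom x y. h (frac_class C x t s) = c t s)"
proof -
  define h where "h X = (let (t, s) = SOME p. p \<in> X in c t s)" for X
  have h: "h (frac_class C x t s) = c t s" if ts: "t \<in> Hom x y" "s \<in> Hom x y" for t s y
  proof -
    obtain t' s' where p: "(SOME p. p \<in> frac_class C x t s) = (t', s')"
      by fastforce
    have "(t, s) \<in> frac_class C x t s"
      using mem_frac_class[OF ts] frac_rel_refl[OF ts] by blast
    then have "(t', s') \<in> frac_class C x t s"
      unfolding p[symmetric] by (rule someI)
    then have "frac_rel x (t, s) (t', s')"
      using mem_frac_class[OF ts] by blast
    then have "c t s = c t' s'"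
    proof cases
      case (frac_relI y z f w f')
      then show ?thesis
        using step[OF frac_relI(1,2,5)] step[OF frac_relI(3,4,6)] by simp
    qed
    then show ?thesis
      unfolding h_def p by simp
  qed
  have "h \<in> hom (Frac C x) K"
  proof (rule homI)
    show "h X \<in> carrier K" if "X \<in> carrier (Frac C x)" for X
      using that unfolding carrier_Frac by (auto simp: h closed)
    show "h (X \<otimes>\<^bsub>Frac C x\<^esub> Y) = h X \<otimes>\<^bsub>K\<^esub> h Y"
      if "X \<in> carrier (Frac C x)" "Y \<in> carrier (Frac C x)" for X Y
      by (rule frac_common_middle[OF that]) (simp add: mult_Frac_middle h mult)
  qed
  then have hom: "group_hom (Frac C x) K h"
    by (simp add: group_hom_def group_hom_axioms_def group_Frac K)
  have "X = \<one>\<^bsub>Frac C x\<^esub>" if X: "X \<in> carrier (Frac C x)" "h X = \<one>\<^bsub>K\<^esub>" for X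
  proof -
    obtain t s y where ts: "t \<in> Hom x y" "s \<in> Hom x y" "X = frac_class C x t s"
      using X(1) unfolding carrier_Frac by blast
    then have "c t s = \<one>\<^bsub>K\<^esub>"
      using X(2) h by simp
    then show ?thesis
      using faithful[OF ts(1,2)] frac_class_one_iff[OF ts(1,2)] ts(3) by simp
  qed
  then have "inj_on h (carrier (Frac C x))"
    using group_hom.inj_on_one_iff[OF hom] by auto
  then show ?thesis
    using hom h by blast
qed

end

section \<open>Stacking of forests\<close>

lemma leaves_Nil [simp]: "leaves [] = 0"
  and leaves_Cons [simp]: "leaves (t # f) = size1 t + leaves f"
  and leaves_append [simp]: "leaves (f @ g) = leaves f + leaves g"
  by (simp_all add: leaves_def)

lemma leaves_replicate_Leaf [simp]: "leaves (replicate n Leaf) = n"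
  by (induction n) auto

lemma length_le_leaves: "length f \<le> leaves f"
proof (induction f)
  case (Cons t f)
  moreover have "0 < size1 t"
    by (simp add: size1_size)
  ultimately show ?case
    unfolding leaves_Cons list.size by linarith
qed simp

lemma length_stack [simp]: "length (stack f g) = length f"
  by (induction f arbitrary: g) auto

lemma size1_graft: "length g = size1 t \<Longrightarrow> size1 (graft t g) = leaves g"
proof (induction t arbitrary: g)
  case Leaf
  then show ?case by (cases g) auto
next
  case (Node l a r)
  have "leaves g = leaves (take (size1 l) g) + leaves (drop (size1 l) g)"
    by (metis append_take_drop_id leaves_append)
  with Node show ?case by simp
qed

lemma stack_append: "leaves f = length g \<Longrightarrow> stack (f @ f') (g @ g') = stack f g @ stack f' g'"
  by (induction f arbitrary: g) auto

lemma leaves_stack: "leaves f = length g \<Longrightarrow> leaves (stack f g) = leaves g"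
proof (induction f arbitrary: g)
  case (Cons t f)
  have "leaves g = leaves (take (size1 t) g) + leaves (drop (size1 t) g)"
    by (metis append_take_drop_id leaves_append)
  with Cons show ?case by (simp add: size1_graft)
qed simp

lemma take_drop_stack:
  assumes "leaves g = length h" "n \<le> length g"
  shows "stack (take n g) (take (leaves (take n g)) h) = take n (stack g h)"
    and "stack (drop n g) (drop (leaves (take n g)) h) = drop n (stack g h)"
proof -
  have len: "leaves (take n g) + leaves (drop n g) = length h"
    using assms by (metis append_take_drop_id leaves_append)
  have "stack (take n g @ drop n g) (take (leaves (take n g)) h @ drop (leaves (take n g)) h) =
      stack (take n g) (take (leaves (take n g)) h) @ stack (drop n g) (drop (leaves (take n g)) h)"
    using len by (intro stack_append) simp
  then have "stack g h = stack (take n g) (take (leaves (take n g)) h) @ stack (drop n g) (drop (leaves (take n g)) h)"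
    by simp
  then show "stack (take n g) (take (leaves (take n g)) h) = take n (stack g h)"
    and "stack (drop n g) (drop (leaves (take n g)) h) = drop n (stack g h)"
    using assms by auto
qed

lemma leaves_take_drop: "leaves (take n g) + leaves (drop n g) = leaves g"
  by (metis append_take_drop_id leaves_append)

lemma graft_graft:
  "length g = size1 t \<Longrightarrow> leaves g = length h \<Longrightarrow> graft (graft t g) h = graft t (stack g h)"
proof (induction t arbitrary: g h)
  case Leaf
  then obtain x where "g = [x]"
    by (auto simp: length_Suc_conv)
  with Leaf show ?case by simp
next
  case (Node l a r)
  have "leaves (take (size1 l) g) + leaves (drop (size1 l) g) = length h"
    using Node.prems leaves_take_drop by metis
  then show ?case
    using Node by (simp add: size1_graft take_drop_stack)
qed

lemma stack_assoc:
  "leaves f = length g \<Longrightarrow> leaves g = length h \<Longrightarrow> stack (stack f g) h = stack f (stack g h)"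
proof (induction f arbitrary: g h)
  case (Cons t f)
  have "leaves (take (size1 t) g) + leaves (drop (size1 t) g) = length h"
    using Cons.prems leaves_take_drop by metis
  then show ?case
    using Cons by (simp add: size1_graft graft_graft take_drop_stack)
qed simp

lemma stack_replicate_Leaf_left: "stack (replicate (length f) Leaf) f = f"
  by (induction f) auto

lemma graft_replicate_Leaf: "graft t (replicate (size1 t) Leaf) = t"
  by (induction t) auto

lemma stack_replicate_Leaf_right: "stack f (replicate (leaves f) Leaf) = f"
  by (induction f) (auto simp: graft_replicate_Leaf)

lemma nth_stack:
  "n < length f \<Longrightarrow> stack f g ! n = graft (f ! n) (take (size1 (f ! n)) (drop (leaves (take n f)) g))"
proof (induction f arbitrary: n g)
  case (Cons t f)
  then show ?case
    by (cases n) (auto simp: add.commute)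
qed simp

locale skein =
  fixes R :: "('a tree \<times> 'a tree) set"
  assumes relations: "skein_relations R"
begin

abbreviation skein_equiv (infix "\<approx>" 50) where "f \<approx> g \<equiv> skein_eq R f g"
abbreviation cls where "cls \<equiv> skein_class R"

lemma skein_eq_length: "f \<approx> g \<Longrightarrow> length f = length g"
  by (induction rule: skein_eq.induct) auto

lemma skein_eq_leaves: "f \<approx> g \<Longrightarrow> leaves f = leaves g"
proof (induction rule: skein_eq.induct)
  case (base t s)
  then show ?case
    using relations by (auto simp: skein_relations_def)
qed (auto simp: leaves_stack dest: skein_eq_length)

lemma skein_eq_stack:
  assumes "f \<approx> f'" "g \<approx> g'" "leaves f = length g"
  shows "stack f g \<approx> stack f' g'"
  using skein_eq.comp_right[OF assms(1,3)] skein_eq.comp_left[OF assms(2), of f'] assms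
    skein_eq_leaves[OF assms(1)] skein_eq.trans by metis

lemma skein_eq_append:
  assumes "f \<approx> f'" "g \<approx> g'"
  shows "f @ g \<approx> f' @ g'"
  using skein_eq.tensor_left[OF assms(2)] skein_eq.tensor_right[OF assms(1)] skein_eq.trans by blast

lemma skein_eq_of_treewise: "list_all2 (\<lambda>t s. [t] \<approx> [s]) f g \<Longrightarrow> f \<approx> g"
proof (induction rule: list_all2_induct)
  case (Cons t f s g)
  then show ?case
    using skein_eq_append[of "[t]" "[s]"] by simp
qed (rule skein_eq.refl)

lemma treewise_graft:
  assumes "[t] \<approx> [s]" "list_all2 (\<lambda>t s. [t] \<approx> [s]) g g'" "length g = size1 t"
  shows "[graft t g] \<approx> [graft s g']"
  using skein_eq_stack[OF assms(1) skein_eq_of_treewise[OF assms(2)]] assms skein_eq_leaves[OF assms(1)]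
    list_all2_lengthD[OF assms(2)] by simp

text \<open>
  Grafting a tree uses a whole block of the forest above it. The blocks of equivalent forests are aligned,
  because related trees have the same number of leaves.
\<close>

lemma treewise_stack:
  assumes "list_all2 (\<lambda>t s. [t] \<approx> [s]) f f'" "list_all2 (\<lambda>t s. [t] \<approx> [s]) g g'" "leaves f = length g"
  shows "list_all2 (\<lambda>t s. [t] \<approx> [s]) (stack f g) (stack f' g')"
  using assms
proof (induction arbitrary: g g' rule: list_all2_induct)
  case (Cons t f s f')
  have "size1 t = size1 s"
    using skein_eq_leaves[OF Cons.hyps(1)] by simp
  then show ?case
    using Cons by (auto intro!: treewise_graft simp: list_all2_takeI list_all2_dropI)
qed simp

text \<open>
  Equivalent forests are equivalent tree by tree, so a forest in the skein category is a list of trees of the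
  category. In particular equations between tensor products can be separated into their factors, which is what
  makes the components of an equation in \<open>\<F>\<^sub>\<infinity>\<close> accessible.
\<close>

lemma skein_eq_treewise: "f \<approx> g \<Longrightarrow> list_all2 (\<lambda>t s. [t] \<approx> [s]) f g"
proof (induction rule: skein_eq.induct)
  case (sym f g)
  then show ?case
    by (auto simp: list_all2_conv_all_nth intro: skein_eq.sym)
next
  case (trans f g h)
  show ?case
    by (rule list_all2_trans[OF skein_eq.trans trans.IH])
qed (auto intro: skein_eq.base skein_eq.refl list_all2_refl list_all2_appendI treewise_stack)

lemma skein_eq_append_iff:
  assumes "length f = length f'"
  shows "f @ g \<approx> f' @ g' \<longleftrightarrow> f \<approx> f' \<and> g \<approx> g'"
  using assms skein_eq_treewise skein_eq_of_treewise skein_eq_append by (metis list_all2_append)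

lemma cls_eq_iff: "cls f = cls g \<longleftrightarrow> f \<approx> g"
  unfolding skein_class_def using skein_eq.refl skein_eq.sym skein_eq.trans by blast

lemma mem_cls: "g \<in> cls f \<longleftrightarrow> f \<approx> g"
  by (simp add: skein_class_def)

lemma skein_roots_cls [simp]: "skein_roots (cls f) = length f"
proof -
  have "length ` cls f = {length f}"
    using skein_eq_length skein_eq.refl by (fastforce simp: skein_class_def)
  then show ?thesis
    by (simp add: skein_roots_def)
qed

lemma skein_leaves_cls [simp]: "skein_leaves (cls f) = leaves f"
proof -
  have "leaves ` cls f = {leaves f}"
    using skein_eq_leaves skein_eq.refl by (fastforce simp: skein_class_def)
  then show ?thesis
    by (simp add: skein_leaves_def)
qed

lemma skein_comp_cls:
  assumes "leaves f = length g"
  shows "skein_comp R (cls f) (cls g) = cls (stack f g)"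
proof -
  have "cls (stack f' g') = cls (stack f g)" if "f \<approx> f'" "g \<approx> g'" for f' g'
    using skein_eq_stack[OF that assms] cls_eq_iff skein_eq.sym by metis
  then have "{cls (stack f' g') | f' g'. f' \<in> cls f \<and> g' \<in> cls g \<and> leaves f' = length g'} = {cls (stack f g)}"
    using assms skein_eq.refl unfolding mem_cls by fast
  then show ?thesis
    unfolding skein_comp_def by simp
qed

lemma skein_tensor_cls: "skein_tensor R (cls f) (cls g) = cls (f @ g)"
proof -
  have "cls (f' @ g') = cls (f @ g)" if "f \<approx> f'" "g \<approx> g'" for f' g'
    using skein_eq_append[OF that] cls_eq_iff skein_eq.sym by metis
  then have "{cls (f' @ g') | f' g'. f' \<in> cls f \<and> g' \<in> cls g} = {cls (f @ g)}"
    using skein_eq.refl unfolding mem_cls by fast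
  then show ?thesis
    unfolding skein_tensor_def by simp
qed

lemma skein_tensor_list_cls: "skein_tensor_list R (map (\<lambda>t. cls [t]) f) = cls f"
  by (induction f) (auto simp: skein_tensor_list_def skein_tensor_cls)

lemma ForC_simps [simp]: "arr (ForC R) = range cls" "src (ForC R) = skein_roots"
  "tgt (ForC R) = skein_leaves" "cmp (ForC R) = skein_comp R" "idn (ForC R) n = cls (replicate n Leaf)"
  by (simp_all add: ForC_def)

end

section \<open>The category of forests and the monoid of sequences\<close>

locale ore_skein = skein +
  assumes ore_ForC: "ore_category (ForC R)"

context ore_skein begin

sublocale ForC: ore_cat "ForC R"
proof
  show "cmp (ForC R) f g \<in> arr (ForC R)"
    and "src (ForC R) (cmp (ForC R) f g) = src (ForC R) f"
    and "tgt (ForC R) (cmp (ForC R) f g) = tgt (ForC R) g"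
    if "f \<in> arr (ForC R)" "g \<in> arr (ForC R)" "tgt (ForC R) f = src (ForC R) g" for f g
    using that by (auto simp: skein_comp_cls leaves_stack)
  show "cmp (ForC R) (cmp (ForC R) f g) h = cmp (ForC R) f (cmp (ForC R) g h)"
    if "f \<in> arr (ForC R)" "g \<in> arr (ForC R)" "h \<in> arr (ForC R)"
      "tgt (ForC R) f = src (ForC R) g" "tgt (ForC R) g = src (ForC R) h" for f g h
    using that by (auto simp: skein_comp_cls leaves_stack stack_assoc)
  show "idn (ForC R) x \<in> arr (ForC R)" "src (ForC R) (idn (ForC R) x) = x" "tgt (ForC R) (idn (ForC R) x) = x" for x
    by simp_all
  show "cmp (ForC R) (idn (ForC R) (src (ForC R) f)) f = f"
    and "cmp (ForC R) f (idn (ForC R) (tgt (ForC R) f)) = f"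
    if "f \<in> arr (ForC R)" for f
    using that by (auto simp: skein_comp_cls stack_replicate_Leaf_left stack_replicate_Leaf_right)
  show "ore_category (ForC R)"
    by (rule ore_ForC)
qed

lemma ForC_Hom: "X \<in> ForC.Hom m n \<longleftrightarrow> (\<exists>f. X = cls f \<and> length f = m \<and> leaves f = n)"
  by (auto simp: ForC.Hom_def)

lemma skein_eq_cancel:
  assumes "stack f g \<approx> stack f h" "leaves f = length g" "length h = length g"
  shows "g \<approx> h"
proof -
  have eq: "skein_comp R (cls f) (cls g) = skein_comp R (cls f) (cls h)"
    using assms by (simp add: skein_comp_cls cls_eq_iff)
  have "cls f \<in> ForC.Hom (length f) (leaves f)" "cls g \<in> ForC.Hom (leaves f) (leaves g)"
      "cls h \<in> ForC.Hom (leaves f) (leaves h)"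
    by (simp_all add: ForC.Hom_def assms(2,3))
  from ForC.cancel_Hom[unfolded ForC_simps, OF this eq] have "cls g = cls h" .
  then show ?thesis
    by (simp add: cls_eq_iff)
qed

lemma skein_eq_common_multiple:
  assumes "length f = length g"
  obtains p q where "leaves f = length p" "leaves g = length q" "stack f p \<approx> stack g q"
proof -
  have "cls f \<in> ForC.Hom (length f) (leaves f)" "cls g \<in> ForC.Hom (length f) (leaves g)"
    using assms by (auto simp: ForC_Hom)
  then obtain w X Y where "X \<in> ForC.Hom (leaves f) w" "Y \<in> ForC.Hom (leaves g) w"
      "skein_comp R (cls f) X = skein_comp R (cls g) Y"
    by (rule ForC.ore_Hom[unfolded ForC_simps])
  then obtain p q where "length p = leaves f" "length q = leaves g"
      "skein_comp R (cls f) (cls p) = skein_comp R (cls g) (cls q)"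
    unfolding ForC_Hom by blast
  then show thesis
    by (intro that) (simp_all add: skein_comp_cls cls_eq_iff)
qed

end

context skein begin

text \<open>
  The sequence \<open>(f\<^sub>0, \<dots>, f\<^sub>n\<^sub>-\<^sub>1, I, I, \<dots>)\<close> of a forest \<open>f\<close>. Every element of \<open>\<F>\<^sub>\<infinity>\<close> has this form, and
  padding \<open>f\<close> with trivial trees does not change it.
\<close>

definition seq_of :: "'a forest \<Rightarrow> nat \<Rightarrow> 'a forest set" where
  "seq_of f n = (if n < length f then cls [f ! n] else cls [Leaf])"

lemma seq_of_pad: "seq_of (f @ replicate d Leaf) = seq_of f"
  by (auto simp: fun_eq_iff seq_of_def nth_append)

lemma seq_of_eq_iff:
  assumes "length f = length g"
  shows "seq_of f = seq_of g \<longleftrightarrow> f \<approx> g"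
proof
  assume *: "seq_of f = seq_of g"
  have "[f ! i] \<approx> [g ! i]" if "i < length f" for i
    using fun_cong[OF *, of i] that assms by (simp add: seq_of_def cls_eq_iff)
  then show "f \<approx> g"
    using assms by (auto intro!: skein_eq_of_treewise simp: list_all2_conv_all_nth)
next
  assume "f \<approx> g"
  then have "[f ! i] \<approx> [g ! i]" if "i < length f" for i
    using skein_eq_treewise that by (auto simp: list_all2_conv_all_nth)
  then show "seq_of f = seq_of g"
    using assms by (auto simp: fun_eq_iff seq_of_def cls_eq_iff)
qed

lemma F_infinity_simps: "one (F_infinity R) = seq_of []"
  "carrier (F_infinity R) = {\<phi>. (\<forall>n. \<phi> n \<in> skein_trees R) \<and> finite {n. \<phi> n \<noteq> trivial_tree R}}"
  by (auto simp: F_infinity_def seq_of_def trivial_tree_def)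

lemma skein_trees_iff: "X \<in> skein_trees R \<longleftrightarrow> (\<exists>t. X = cls [t])"
  by (auto simp: skein_trees_def length_Suc_conv)

lemma carrier_F_infinity: "carrier (F_infinity R) = range seq_of"
proof (intro equalityI subsetI)
  fix \<phi> assume "\<phi> \<in> carrier (F_infinity R)"
  then have \<phi>: "\<And>n. \<exists>t. \<phi> n = cls [t]" "finite {n. \<phi> n \<noteq> cls [Leaf]}"
    by (auto simp: F_infinity_simps skein_trees_iff trivial_tree_def)
  obtain \<tau> where \<tau>: "\<And>n. \<phi> n = cls [\<tau> n]"
    using \<phi>(1) by metis
  obtain N where N: "\<And>n. \<phi> n \<noteq> cls [Leaf] \<Longrightarrow> n < N"
    using \<phi>(2) by (auto simp: finite_nat_set_iff_bounded)
  have "\<phi> = seq_of (map \<tau> [0..<N])"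
  proof
    show "\<phi> n = seq_of (map \<tau> [0..<N]) n" for n
      using N[of n] by (auto simp: seq_of_def \<tau>)
  qed
  then show "\<phi> \<in> range seq_of"
    by blast
next
  fix \<phi> assume "\<phi> \<in> range seq_of"
  then obtain f where f: "\<phi> = seq_of f"
    by blast
  have "{n. seq_of f n \<noteq> cls [Leaf]} \<subseteq> {..<length f}"
    by (auto simp: seq_of_def)
  then have "finite {n. seq_of f n \<noteq> cls [Leaf]}"
    by (rule finite_subset) simp
  then show "\<phi> \<in> carrier (F_infinity R)"
    by (auto simp: f F_infinity_simps skein_trees_iff trivial_tree_def seq_of_def)
qed

lemma seq_of_in_carrier [simp]: "seq_of f \<in> carrier (F_infinity R)"
  by (simp add: carrier_F_infinity)

lemma leaf_offset_seq_of: "leaf_offset (seq_of f) n = leaves (take n f) + (n - length f)"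
proof (induction n)
  case (Suc n)
  have "leaf_offset (seq_of f) (Suc n) = leaf_offset (seq_of f) n + skein_leaves (seq_of f n)"
    by (simp add: leaf_offset_def)
  also have "skein_leaves (seq_of f n) = (if n < length f then size1 (f ! n) else 1)"
    by (simp add: seq_of_def)
  finally show ?case
    using Suc by (simp add: take_Suc_conv_app_nth Suc_diff_le)
qed (simp add: leaf_offset_def)

text \<open>
  On forests of matching sizes the product of \<open>\<F>\<^sub>\<infinity>\<close> is the stacking of forests. Any finite set of elements can
  be padded to matching sizes, so every law of \<open>\<F>\<^sub>\<infinity>\<close> is inherited from a law of stacking.
\<close>

lemma seq_of_mult:
  assumes "leaves f = length g"
  shows "seq_of f \<otimes>\<^bsub>F_infinity R\<^esub> seq_of g = seq_of (stack f g)"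
proof
  fix n
  define a where "a = leaf_offset (seq_of f) n"
  define b where "b = leaf_offset (seq_of f) (Suc n)"
  define t where "t = (if n < length f then f ! n else Leaf)"
  define \<sigma> where "\<sigma> i = (if i < length g then g ! i else Leaf)" for i
  have seq_of_f: "seq_of f n = cls [t]" and b: "b = a + size1 t"
    by (simp_all add: a_def b_def t_def leaf_offset_def seq_of_def)
  have "map (seq_of g) [a..<b] = map (\<lambda>s. cls [s]) (map \<sigma> [a..<b])"
    by (simp add: seq_of_def \<sigma>_def)
  then have "(seq_of f \<otimes>\<^bsub>F_infinity R\<^esub> seq_of g) n = skein_comp R (cls [t]) (cls (map \<sigma> [a..<b]))"
    by (simp only: F_infinity_def monoid.simps seq_of_f skein_tensor_list_cls flip: a_def b_def)
  also have "\<dots> = cls [graft t (map \<sigma> [a..<b])]"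
    using b by (simp add: skein_comp_cls)
  also have "\<dots> = seq_of (stack f g) n"
  proof (cases "n < length f")
    case True
    have a: "a = leaves (take n f)"
      using True by (simp add: a_def leaf_offset_seq_of)
    have "b = leaves (take (Suc n) f)"
      using True by (simp add: b_def leaf_offset_seq_of)
    then have "b \<le> length g"
      using assms leaves_take_drop[of "Suc n" f] by simp
    then have "map \<sigma> [a..<b] = take (size1 t) (drop a g)"
      using b by (intro nth_equalityI) (auto simp: \<sigma>_def)
    then show ?thesis
      using True a by (simp add: seq_of_def nth_stack t_def)
  next
    case False
    then have "length g \<le> a"
      using assms by (simp add: a_def leaf_offset_seq_of)
    then have "map \<sigma> [a..<b] = [Leaf]"
      using False b by (simp add: t_def \<sigma>_def)
    then show ?thesis
      using False by (simp add: seq_of_def t_def)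
  qed
  finally show "(seq_of f \<otimes>\<^bsub>F_infinity R\<^esub> seq_of g) n = seq_of (stack f g) n" .
qed

lemma seq_of_long:
  assumes "\<phi> \<in> carrier (F_infinity R)"
  obtains N where "\<And>n. n \<ge> N \<Longrightarrow> \<exists>f. \<phi> = seq_of f \<and> length f = n"
proof -
  obtain f where f: "\<phi> = seq_of f"
    using assms by (auto simp: carrier_F_infinity)
  have "\<exists>f. \<phi> = seq_of f \<and> length f = n" if "n \<ge> length f" for n
    using that f seq_of_pad[of f "n - length f"] by (intro exI[of _ "f @ replicate (n - length f) Leaf"]) simp
  then show thesis
    by (rule that)
qed

lemma seq_of_many_leaves:
  assumes "\<phi> \<in> carrier (F_infinity R)"
  obtains N where "\<And>n. n \<ge> N \<Longrightarrow> \<exists>f. \<phi> = seq_of f \<and> leaves f = n"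
proof -
  obtain f where f: "\<phi> = seq_of f"
    using assms by (auto simp: carrier_F_infinity)
  have "\<exists>f. \<phi> = seq_of f \<and> leaves f = n" if "n \<ge> leaves f" for n
    using that f seq_of_pad[of f "n - leaves f"] by (intro exI[of _ "f @ replicate (n - leaves f) Leaf"]) simp
  then show thesis
    by (rule that)
qed

text \<open>
  The forest for \<open>\<psi>\<close> is padded to \<open>n\<close> leaves first; if \<open>n\<close> is large, its length is at least the number of leaves of
  the forest for \<open>\<phi>\<close>, which can then be padded to match.
\<close>

lemma seq_of_composable:
  assumes "\<phi> \<in> carrier (F_infinity R)" "\<psi> \<in> carrier (F_infinity R)"
  obtains N where "\<And>n. n \<ge> N \<Longrightarrow> \<exists>f g. \<phi> = seq_of f \<and> \<psi> = seq_of g \<and> leaves f = length g \<and> leaves g = n"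
proof -
  obtain M where M: "\<And>n. n \<ge> M \<Longrightarrow> \<exists>f. \<phi> = seq_of f \<and> leaves f = n"
    using seq_of_many_leaves[OF assms(1)] by blast
  obtain g where g: "\<psi> = seq_of g"
    using assms by (auto simp: carrier_F_infinity)
  have "\<exists>f g. \<phi> = seq_of f \<and> \<psi> = seq_of g \<and> leaves f = length g \<and> leaves g = n" if n: "n \<ge> M + leaves g" for n
  proof -
    define g' where "g' = g @ replicate (n - leaves g) Leaf"
    have "M \<le> length g'" "leaves g' = n"
      using n by (simp_all add: g'_def)
    moreover have "\<psi> = seq_of g'"
      by (simp add: g g'_def seq_of_pad)
    ultimately show ?thesis
      using M by metis
  qed
  then show thesis
    by (rule that)
qed

end

lemma monoid_cat_simps [simp]: "arr (monoid_cat M) = carrier M" "src (monoid_cat M) \<phi> = ()"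
  "tgt (monoid_cat M) \<phi> = ()" "cmp (monoid_cat M) = mult M" "idn (monoid_cat M) x = one M"
  by (simp_all add: monoid_cat_def)

context ore_skein begin

sublocale F_infinity: monoid "F_infinity R"
proof
  fix \<phi> \<psi> \<chi>
  assume 1: "\<phi> \<in> carrier (F_infinity R)" and 2: "\<psi> \<in> carrier (F_infinity R)"
  obtain f g where fg: "\<phi> = seq_of f" "\<psi> = seq_of g" "leaves f = length g"
    using seq_of_composable[OF 1 2] by (metis order_refl)
  then show "\<phi> \<otimes>\<^bsub>F_infinity R\<^esub> \<psi> \<in> carrier (F_infinity R)"
    by (simp add: seq_of_mult)
  assume 3: "\<chi> \<in> carrier (F_infinity R)"
  obtain M where M: "\<And>n. n \<ge> M \<Longrightarrow> \<exists>f g. \<phi> = seq_of f \<and> \<psi> = seq_of g \<and> leaves f = length g \<and> leaves g = n"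
    using seq_of_composable[OF 1 2] by blast
  obtain N where N: "\<And>n. n \<ge> N \<Longrightarrow> \<exists>h. \<chi> = seq_of h \<and> length h = n"
    using seq_of_long[OF 3] by blast
  obtain f g h where "\<phi> = seq_of f" "\<psi> = seq_of g" "\<chi> = seq_of h" "leaves f = length g" "leaves g = length h"
    using M[of "max M N"] N[of "max M N"] by auto
  then show "\<phi> \<otimes>\<^bsub>F_infinity R\<^esub> \<psi> \<otimes>\<^bsub>F_infinity R\<^esub> \<chi> = \<phi> \<otimes>\<^bsub>F_infinity R\<^esub> (\<psi> \<otimes>\<^bsub>F_infinity R\<^esub> \<chi>)"
    by (simp add: seq_of_mult leaves_stack stack_assoc)
next
  show "\<one>\<^bsub>F_infinity R\<^esub> \<in> carrier (F_infinity R)"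
    by (simp add: F_infinity_simps(1))
next
  fix \<phi> assume "\<phi> \<in> carrier (F_infinity R)"
  then obtain f where f: "\<phi> = seq_of f"
    by (auto simp: carrier_F_infinity)
  have one: "\<one>\<^bsub>F_infinity R\<^esub> = seq_of (replicate n Leaf)" for n
    using seq_of_pad[of "[]" n] by (simp add: F_infinity_simps(1))
  show "\<one>\<^bsub>F_infinity R\<^esub> \<otimes>\<^bsub>F_infinity R\<^esub> \<phi> = \<phi>"
    using one[of "length f"] by (simp add: f seq_of_mult stack_replicate_Leaf_left)
  show "\<phi> \<otimes>\<^bsub>F_infinity R\<^esub> \<one>\<^bsub>F_infinity R\<^esub> = \<phi>"
    using one[of "leaves f"] by (simp add: f seq_of_mult stack_replicate_Leaf_right)
qed

lemma F_infinity_left_cancel: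
  assumes "\<phi> \<in> carrier (F_infinity R)" "\<psi> \<in> carrier (F_infinity R)" "\<chi> \<in> carrier (F_infinity R)"
    and eq: "\<phi> \<otimes>\<^bsub>F_infinity R\<^esub> \<psi> = \<phi> \<otimes>\<^bsub>F_infinity R\<^esub> \<chi>"
  shows "\<psi> = \<chi>"
proof -
  obtain L where L: "\<And>n. n \<ge> L \<Longrightarrow> \<exists>f. \<phi> = seq_of f \<and> leaves f = n"
    using seq_of_many_leaves[OF assms(1)] by blast
  obtain M where M: "\<And>n. n \<ge> M \<Longrightarrow> \<exists>f. \<psi> = seq_of f \<and> length f = n"
    using seq_of_long[OF assms(2)] by blast
  obtain N where N: "\<And>n. n \<ge> N \<Longrightarrow> \<exists>f. \<chi> = seq_of f \<and> length f = n"
    using seq_of_long[OF assms(3)] by blast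
  obtain f g h where fgh: "\<phi> = seq_of f" "\<psi> = seq_of g" "\<chi> = seq_of h" "leaves f = length g" "length h = length g"
    using L[of "L + M + N"] M[of "L + M + N"] N[of "L + M + N"] by auto
  then have "seq_of (stack f g) = seq_of (stack f h)"
    using eq by (simp add: seq_of_mult)
  then have "stack f g \<approx> stack f h"
    by (simp add: seq_of_eq_iff)
  then have "g \<approx> h"
    by (rule skein_eq_cancel[OF _ fgh(4,5)])
  then show ?thesis
    using fgh by (simp add: seq_of_eq_iff)
qed

lemma F_infinity_common_multiple:
  assumes "\<phi> \<in> carrier (F_infinity R)" "\<psi> \<in> carrier (F_infinity R)"
  shows "\<exists>\<alpha> \<in> carrier (F_infinity R). \<exists>\<beta> \<in> carrier (F_infinity R).
    \<phi> \<otimes>\<^bsub>F_infinity R\<^esub> \<alpha> = \<psi> \<otimes>\<^bsub>F_infinity R\<^esub> \<beta>"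
proof -
  obtain M where M: "\<And>n. n \<ge> M \<Longrightarrow> \<exists>f. \<phi> = seq_of f \<and> length f = n"
    using seq_of_long[OF assms(1)] by blast
  obtain N where N: "\<And>n. n \<ge> N \<Longrightarrow> \<exists>f. \<psi> = seq_of f \<and> length f = n"
    using seq_of_long[OF assms(2)] by blast
  obtain f g where fg: "\<phi> = seq_of f" "\<psi> = seq_of g" "length f = length g"
    using M[of "M + N"] N[of "M + N"] by auto
  obtain p q where "leaves f = length p" "leaves g = length q" "stack f p \<approx> stack g q"
    using skein_eq_common_multiple[OF fg(3)] by blast
  then have "seq_of f \<otimes>\<^bsub>F_infinity R\<^esub> seq_of p = seq_of g \<otimes>\<^bsub>F_infinity R\<^esub> seq_of q"
    using fg(3) by (simp add: seq_of_mult seq_of_eq_iff)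
  then show ?thesis
    using fg seq_of_in_carrier by blast
qed

sublocale Fcat: ore_cat "monoid_cat (F_infinity R)"
proof
  show "ore_category (monoid_cat (F_infinity R))"
    unfolding ore_category_def left_cancellative_def monoid_cat_simps
    by (intro conjI ballI impI) (erule (3) F_infinity_left_cancel, simp add: F_infinity_common_multiple)
qed (simp_all add: F_infinity.m_assoc)

lemma Fcat_Hom [simp]: "Fcat.Hom x y = carrier (F_infinity R)"
  by (auto simp: Fcat.Hom_def)

end

section \<open>Vines and the embedding of sequences into trees\<close>

text \<open>
  The right vine \<open>a(f\<^sub>0, a(f\<^sub>1, \<dots> a(f\<^sub>n\<^sub>-\<^sub>1, x)))\<close>: a comb with \<open>n\<close> vertices of colour \<open>a\<close> that carries the forest \<open>f\<close>
  on its first \<open>n\<close> leaves and \<open>x\<close> on the last one. The last leaf is where further vertices are added, so it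
  represents the tail of a sequence.
\<close>

definition vine :: "'a \<Rightarrow> 'a forest \<Rightarrow> 'a tree \<Rightarrow> 'a tree" where
  "vine a f x = foldr (\<lambda>t s. Node t a s) f x"

lemma vine_Nil [simp]: "vine a [] x = x"
  and vine_Cons [simp]: "vine a (t # f) x = Node t a (vine a f x)"
  and vine_append [simp]: "vine a (f @ g) x = vine a f (vine a g x)"
  by (simp_all add: vine_def)

lemma size1_vine [simp]: "size1 (vine a f x) = leaves f + size1 x"
  by (induction f) auto

lemma graft_vine:
  "length g = leaves f \<Longrightarrow> length h = size1 x \<Longrightarrow> graft (vine a f x) (g @ h) = vine a (stack f g) (graft x h)"
  by (induction f arbitrary: g) auto

text \<open>
  A vine is its comb with \<open>f \<otimes> x\<close> stacked on top; hence vines respect the skein relations, and the common comb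
  of two vines of equal length can be cancelled.
\<close>

lemma vine_eq_graft: "vine a f x = graft (vine a (replicate (length f) Leaf) Leaf) (f @ [x])"
  by (simp add: graft_vine stack_replicate_Leaf_left)

context skein begin

lemma vine_cong: "f \<approx> g \<Longrightarrow> [vine a f x] \<approx> [vine a g x]"
proof -
  assume fg: "f \<approx> g"
  have "stack [vine a (replicate (length f) Leaf) Leaf] (f @ [x]) \<approx>
      stack [vine a (replicate (length f) Leaf) Leaf] (g @ [x])"
    using fg skein_eq.refl by (intro skein_eq_stack skein_eq_append) simp_all
  then show ?thesis
    using skein_eq_length[OF fg] vine_eq_graft[of a f x] vine_eq_graft[of a g x] by simp
qed

end

context ore_skein begin

lemma vine_cancel:
  assumes "length f = length g" "[vine a f x] \<approx> [vine a g y]"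
  shows "f \<approx> g" and "[x] \<approx> [y]"
proof -
  have "stack [vine a (replicate (length f) Leaf) Leaf] (f @ [x]) \<approx>
      stack [vine a (replicate (length f) Leaf) Leaf] (g @ [y])"
    using assms vine_eq_graft[of a f x] vine_eq_graft[of a g y] by simp
  then have "f @ [x] \<approx> g @ [y]"
    by (rule skein_eq_cancel) (simp_all add: assms(1))
  then show "f \<approx> g" "[x] \<approx> [y]"
    using skein_eq_append_iff[OF assms(1)] by simp_all
qed

text \<open>
  The two forests may differ in length a priori. After cancelling the shorter comb, the last entry
  of the longer vine would be a tree equivalent to \<open>x\<close> that contains \<open>x\<close> and has additional leaves; since
  the skein relations preserve the number of leaves, there are none.
\<close>

lemma vine_inj:
  assumes "[vine a f x] \<approx> [vine a g x]"
  shows "f \<approx> g"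
proof -
  have le: "f \<approx> g" if eq: "[vine a f x] \<approx> [vine a g x]" and le: "length f \<le> length g" for f g
  proof -
    \<comment> \<open>\<open>g1\<close> sits on the part of the comb that \<open>f\<close> shares, \<open>g2\<close> on the surplus.\<close>
    define g1 where "g1 = take (length f) g"
    define g2 where "g2 = drop (length f) g"
    have g: "g = g1 @ g2" and len: "length f = length g1"
      using le by (simp_all add: g1_def g2_def)
    have *: "[vine a f x] \<approx> [vine a g1 (vine a g2 x)]"
      using eq by (simp add: g)
    have "leaves [x] = leaves [vine a g2 x]"
      by (rule skein_eq_leaves[OF vine_cancel(2)[OF len *]])
    then have "g2 = []"
      using length_le_leaves[of g2] by simp
    then show ?thesis
      using vine_cancel(1)[OF len *] g by simp
  qed
  show ?thesis
    using le[OF assms] le[OF skein_eq.sym[OF assms]] skein_eq.sym by (meson nat_le_linear)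
qed

text \<open>
  The vine on a representing forest of \<open>\<phi>\<close> with exactly \<open>m\<close> leaves. Indexing by leaves, not by roots, allows
  fractions to be formed: \<open>\<phi>\<close> and \<open>\<psi>\<close> may need different numbers of roots to reach \<open>m\<close> leaves.
\<close>

definition stage :: "'a \<Rightarrow> (nat \<Rightarrow> 'a forest set) \<Rightarrow> nat \<Rightarrow> 'a forest set \<Rightarrow> bool" where
  "stage a \<phi> m T \<longleftrightarrow> (\<exists>f. \<phi> = seq_of f \<and> leaves f = m \<and> T = cls [vine a f Leaf])"

lemma stage_exists:
  assumes "\<phi> \<in> carrier (F_infinity R)"
  obtains N where "\<And>m. m \<ge> N \<Longrightarrow> \<exists>T. stage a \<phi> m T"
proof -
  obtain N where "\<And>m. m \<ge> N \<Longrightarrow> \<exists>f. \<phi> = seq_of f \<and> leaves f = m"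
    using seq_of_many_leaves[OF assms] by blast
  then have "\<And>m. m \<ge> N \<Longrightarrow> \<exists>T. stage a \<phi> m T"
    unfolding stage_def by blast
  then show thesis
    by (rule that)
qed

lemma stage_Hom: "stage a \<phi> m T \<Longrightarrow> T \<in> ForC.Hom 1 (Suc m)"
  unfolding stage_def ForC_Hom by (elim exE, rule_tac x = "[vine a f Leaf]" in exI) simp

text \<open>
  The forest that represents \<open>\<phi>\<close> is determined up to the skein relations and padding by trivial trees, and
  padding changes the number of leaves.
\<close>

lemma stage_unique:
  assumes "stage a \<phi> m T" "stage a \<phi> m S"
  shows "T = S"
proof -
  have le: "f \<approx> g" if "seq_of f = seq_of g" "leaves f = leaves g" "length f \<le> length g" for f g
  proof -
    define d where "d = length g - length f"
    have "f @ replicate d Leaf \<approx> g"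
      using that seq_of_eq_iff[of "f @ replicate d Leaf" g] by (simp add: d_def seq_of_pad)
    moreover from skein_eq_leaves[OF this] have "d = 0"
      using that by simp
    ultimately show ?thesis
      by simp
  qed
  obtain f g where fg: "\<phi> = seq_of f" "\<phi> = seq_of g" "leaves f = m" "leaves g = m"
      "T = cls [vine a f Leaf]" "S = cls [vine a g Leaf]"
    using assms unfolding stage_def by blast
  have "f \<approx> g"
    using le[of f g] le[of g f] fg skein_eq.sym by (metis nat_le_linear)
  then show ?thesis
    using fg vine_cong by (simp add: cls_eq_iff)
qed

text \<open>
  Padding by \<open>d\<close> trivial trees extends the comb by \<open>d\<close> vertices on its last leaf, which is a composition by a
  forest that depends on \<open>m\<close> and \<open>d\<close> only.
\<close>

lemma stage_add:
  assumes "stage a \<phi> m T"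
  shows "stage a \<phi> (m + d) (skein_comp R T (cls (replicate m Leaf @ [vine a (replicate d Leaf) Leaf])))"
proof -
  obtain f where f: "\<phi> = seq_of f" "leaves f = m" "T = cls [vine a f Leaf]"
    using assms unfolding stage_def by blast
  have "skein_comp R T (cls (replicate m Leaf @ [vine a (replicate d Leaf) Leaf])) =
      cls [vine a (f @ replicate d Leaf) Leaf]"
    using f stack_replicate_Leaf_right[of f] by (simp add: skein_comp_cls graft_vine)
  then show ?thesis
    unfolding stage_def using f by (intro exI[of _ "f @ replicate d Leaf"]) (simp add: seq_of_pad)
qed

lemma stage_mult:
  assumes "stage a \<phi> (length h) T"
  shows "stage a (\<phi> \<otimes>\<^bsub>F_infinity R\<^esub> seq_of h) (leaves h) (skein_comp R T (cls (h @ [Leaf])))"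
proof -
  obtain f where f: "\<phi> = seq_of f" "leaves f = length h" "T = cls [vine a f Leaf]"
    using assms unfolding stage_def by blast
  then show ?thesis
    unfolding stage_def
    by (intro exI[of _ "stack f h"]) (simp add: seq_of_mult leaves_stack skein_comp_cls graft_vine)
qed

text \<open>
  The choice is immaterial: all common stages of \<open>\<phi>\<close> and \<open>\<psi>\<close> yield the same fraction.
\<close>

definition gamma_class ::
    "'a \<Rightarrow> (nat \<Rightarrow> 'a forest set) \<Rightarrow> (nat \<Rightarrow> 'a forest set) \<Rightarrow> ('a forest set \<times> 'a forest set) set" where
  "gamma_class a \<phi> \<psi> = (SOME X. \<exists>m T S. stage a \<phi> m T \<and> stage a \<psi> m S \<and> X = frac_class (ForC R) 1 T S)"

text \<open>
  Moving to a later stage expands numerator and denominator by the same forest.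
\<close>

lemma frac_class_stage:
  assumes "stage a \<phi> m T" "stage a \<psi> m S" "stage a \<phi> n T'" "stage a \<psi> n S'"
  shows "frac_class (ForC R) 1 T S = frac_class (ForC R) 1 T' S'"
proof -
  have le: "frac_class (ForC R) 1 T S = frac_class (ForC R) 1 T' S'"
    if 1: "stage a \<phi> m T" "stage a \<psi> m S" and 2: "stage a \<phi> n T'" "stage a \<psi> n S'" and le: "m \<le> n"
    for m n T S T' S'
  proof -
    define E where "E = cls (replicate m Leaf @ [vine a (replicate (n - m) Leaf) Leaf])"
    have E: "E \<in> ForC.Hom (Suc m) (Suc n)"
      using le unfolding E_def ForC_Hom by (intro exI conjI) (rule HOL.refl, simp_all)
    have "T' = skein_comp R T E" "S' = skein_comp R S E"
      using stage_unique[OF 2(1)] stage_unique[OF 2(2)]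
        stage_add[OF 1(1), of "n - m"] stage_add[OF 1(2), of "n - m"] le by (simp_all add: E_def)
    then show ?thesis
      using ForC.frac_class_cmp[OF stage_Hom[OF 1(1)] stage_Hom[OF 1(2)] E] by simp
  qed
  show ?thesis
    using le[OF assms] le[OF assms(3,4,1,2)] by (cases "m \<le> n") simp_all
qed

lemma gamma_class_stage:
  assumes "stage a \<phi> m T" "stage a \<psi> m S"
  shows "gamma_class a \<phi> \<psi> = frac_class (ForC R) 1 T S"
proof -
  have "\<exists>m T S. stage a \<phi> m T \<and> stage a \<psi> m S \<and> gamma_class a \<phi> \<psi> = frac_class (ForC R) 1 T S"
    unfolding gamma_class_def by (rule someI_ex) (use assms in blast)
  then obtain n T' S' where st: "stage a \<phi> n T'" "stage a \<psi> n S'"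
      and eq: "gamma_class a \<phi> \<psi> = frac_class (ForC R) 1 T' S'"
    by blast
  show ?thesis
    unfolding eq by (rule frac_class_stage[OF st assms])
qed

lemma common_stage:
  assumes "\<phi> \<in> carrier (F_infinity R)" "\<psi> \<in> carrier (F_infinity R)" "\<chi> \<in> carrier (F_infinity R)"
  obtains N where "\<And>m. m \<ge> N \<Longrightarrow> \<exists>T S U. stage a \<phi> m T \<and> stage a \<psi> m S \<and> stage a \<chi> m U"
proof -
  obtain L where L: "\<And>m. m \<ge> L \<Longrightarrow> \<exists>T. stage a \<phi> m T"
    using stage_exists[OF assms(1)] by blast
  obtain M where M: "\<And>m. m \<ge> M \<Longrightarrow> \<exists>T. stage a \<psi> m T"
    using stage_exists[OF assms(2)] by blast
  obtain N where N: "\<And>m. m \<ge> N \<Longrightarrow> \<exists>T. stage a \<chi> m T"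
    using stage_exists[OF assms(3)] by blast
  have "\<exists>T S U. stage a \<phi> m T \<and> stage a \<psi> m S \<and> stage a \<chi> m U" if "m \<ge> L + M + N" for m
    using L[of m] M[of m] N[of m] that by auto
  then show thesis
    by (rule that)
qed

text \<open>
  The map \<open>[\<phi>, \<psi>] \<mapsto> [T, S]\<close>, where \<open>T\<close> and \<open>S\<close> are the vines of \<open>\<phi>\<close> and \<open>\<psi>\<close> at a common stage. If \<open>[T, S]\<close> is trivial, a
  forest \<open>h \<otimes> x\<close> equalises the two vines, and then \<open>h\<close> equalises \<open>\<phi>\<close> and \<open>\<psi>\<close>.
\<close>

lemma gamma_embedding:
  "\<exists>\<gamma>. group_hom (Frac_monoid (F_infinity R)) (Frac (ForC R) 1) \<gamma> \<and>
    inj_on \<gamma> (carrier (Frac_monoid (F_infinity R))) \<and>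
    (\<forall>\<phi> \<in> carrier (F_infinity R). \<forall>\<psi> \<in> carrier (F_infinity R).
      \<gamma> (frac_class (monoid_cat (F_infinity R)) () \<phi> \<psi>) = gamma_class a \<phi> \<psi>)"
  unfolding Frac_monoid_def
proof (rule Fcat.Frac_embedding[where x = "()" and c = "gamma_class a",
      unfolded Fcat_Hom monoid_cat_simps simp_thms])
  show "group (Frac (ForC R) 1)"
    by (rule ForC.group_Frac)
next
  fix \<phi> \<psi>
  assume 1: "\<phi> \<in> carrier (F_infinity R)" "\<psi> \<in> carrier (F_infinity R)"
  obtain m T S where st: "stage a \<phi> m T" "stage a \<psi> m S"
    by (rule common_stage[OF 1 1(2)]) blast
  show "gamma_class a \<phi> \<psi> \<in> carrier (Frac (ForC R) 1)"
    unfolding gamma_class_stage[OF st] using stage_Hom[OF st(1)] stage_Hom[OF st(2)]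
    by (rule ForC.frac_class_in_carrier)
next
  fix \<phi> \<psi> \<chi>
  assume 1: "\<phi> \<in> carrier (F_infinity R)" "\<psi> \<in> carrier (F_infinity R)" and 2: "\<chi> \<in> carrier (F_infinity R)"
  obtain M where M: "\<And>m. m \<ge> M \<Longrightarrow> \<exists>T S U. stage a \<phi> m T \<and> stage a \<psi> m S \<and> stage a \<psi> m U"
    using common_stage[OF 1 1(2)] by blast
  obtain N where N: "\<And>n. n \<ge> N \<Longrightarrow> \<exists>h. \<chi> = seq_of h \<and> length h = n"
    using seq_of_long[OF 2] by blast
  obtain h T S where h: "\<chi> = seq_of h" and st: "stage a \<phi> (length h) T" "stage a \<psi> (length h) S"
    using M[of "M + N"] N[of "M + N"] by auto
  have E: "cls (h @ [Leaf]) \<in> ForC.Hom (Suc (length h)) (Suc (leaves h))"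
    unfolding ForC_Hom by (intro exI conjI) (rule HOL.refl, simp_all)
  show "gamma_class a (\<phi> \<otimes>\<^bsub>F_infinity R\<^esub> \<chi>) (\<psi> \<otimes>\<^bsub>F_infinity R\<^esub> \<chi>) = gamma_class a \<phi> \<psi>"
    unfolding h gamma_class_stage[OF st] gamma_class_stage[OF stage_mult[OF st(1)] stage_mult[OF st(2)]]
    using ForC.frac_class_cmp[OF stage_Hom[OF st(1)] stage_Hom[OF st(2)] E] by simp
next
  fix \<phi> \<psi> \<chi>
  assume "\<phi> \<in> carrier (F_infinity R)" "\<psi> \<in> carrier (F_infinity R)" "\<chi> \<in> carrier (F_infinity R)"
  then obtain m T S U where st: "stage a \<phi> m T" "stage a \<psi> m S" "stage a \<chi> m U"
    by (rule common_stage) blast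
  show "gamma_class a \<phi> \<psi> \<otimes>\<^bsub>Frac (ForC R) 1\<^esub> gamma_class a \<psi> \<chi> = gamma_class a \<phi> \<chi>"
    unfolding gamma_class_stage[OF st(1,2)] gamma_class_stage[OF st(2,3)] gamma_class_stage[OF st(1,3)]
    using stage_Hom[OF st(1)] stage_Hom[OF st(2)] stage_Hom[OF st(3)] by (rule ForC.mult_Frac_middle)
next
  fix \<phi> \<psi>
  assume 1: "\<phi> \<in> carrier (F_infinity R)" "\<psi> \<in> carrier (F_infinity R)"
    and one: "gamma_class a \<phi> \<psi> = \<one>\<^bsub>Frac (ForC R) 1\<^esub>"
  obtain m T S where st: "stage a \<phi> m T" "stage a \<psi> m S"
    by (rule common_stage[OF 1 1(2)]) blast
  obtain f where f: "\<phi> = seq_of f" "leaves f = m" "T = cls [vine a f Leaf]"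
    using st(1) unfolding stage_def by blast
  obtain g where g: "\<psi> = seq_of g" "leaves g = m" "S = cls [vine a g Leaf]"
    using st(2) unfolding stage_def by blast
  obtain n Z where Z: "Z \<in> ForC.Hom (Suc m) n" "skein_comp R T Z = skein_comp R S Z"
    using one ForC.frac_class_one_iff[OF stage_Hom[OF st(1)] stage_Hom[OF st(2)]]
    unfolding gamma_class_stage[OF st] ForC_simps by blast
  then obtain z where z: "length z = Suc m" "skein_comp R T (cls z) = skein_comp R S (cls z)"
    by (auto simp: ForC_Hom)
  obtain h x where hx: "z = h @ [x]" "length h = m"
    using z(1) by (cases z rule: rev_cases) auto
  have "[vine a (stack f h) x] \<approx> [vine a (stack g h) x]"
    using z(2) f g hx by (simp add: skein_comp_cls graft_vine cls_eq_iff)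
  then have "stack f h \<approx> stack g h"
    by (rule vine_inj)
  then have "\<phi> \<otimes>\<^bsub>F_infinity R\<^esub> seq_of h = \<psi> \<otimes>\<^bsub>F_infinity R\<^esub> seq_of h"
    using f g hx skein_eq_length by (fastforce simp: seq_of_mult seq_of_eq_iff)
  then show "\<exists>\<chi>\<in>carrier (F_infinity R). \<phi> \<otimes>\<^bsub>F_infinity R\<^esub> \<chi> = \<psi> \<otimes>\<^bsub>F_infinity R\<^esub> \<chi>"
    by auto
qed

end

section \<open>The embedding of trees into sequences\<close>

context ore_skein begin

definition at_root :: "nat \<Rightarrow> 'a forest set \<Rightarrow> nat \<Rightarrow> 'a forest set" where
  "at_root k X = (\<lambda>i. if i = k then X else trivial_tree R)"

lemma at_root_cls: "at_root k (cls [t]) = seq_of (replicate k Leaf @ [t])"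
  by (auto simp: fun_eq_iff at_root_def seq_of_def trivial_tree_def nth_append)

lemma stack_replicate_Leaf_append:
  assumes "length g = k"
  shows "stack (replicate k Leaf @ f) (g @ h) = g @ stack f h"
  using assms stack_append[of "replicate k Leaf" g f h] stack_replicate_Leaf_left[of g] by simp

text \<open>
  The leaves of a tree at root \<open>k\<close> come right after the \<open>k\<close> leaves of the trivial trees before it, so a forest on
  top of it enters \<open>\<F>\<^sub>\<infinity>\<close> shifted by \<open>k\<close> places.
\<close>

lemma at_root_mult:
  assumes "size1 t = length f"
  shows "at_root k (cls [t]) \<otimes>\<^bsub>F_infinity R\<^esub> seq_of (replicate k Leaf @ f) = at_root k (cls (stack [t] f))"
  using assms by (simp add: at_root_cls seq_of_mult stack_replicate_Leaf_append)

lemma ForC_Hom_1: "X \<in> ForC.Hom (Suc 0) n \<longleftrightarrow> (\<exists>t. X = cls [t] \<and> size1 t = n)"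
  by (auto simp: ForC_Hom length_Suc_conv)

lemma at_root_in_carrier: "X \<in> ForC.Hom (Suc 0) n \<Longrightarrow> at_root k X \<in> carrier (F_infinity R)"
  by (auto simp: ForC_Hom_1 at_root_cls)

text \<open>
  If \<open>[X, Y]\<close> placed at root \<open>k\<close> becomes trivial, then some sequence equalises both placements. The trees of that
  sequence over the leaves of \<open>X\<close> form a forest \<open>f\<close>, and comparing the components at \<open>k\<close> gives \<open>Xf = Yf\<close>.
\<close>

lemma eta_embedding:
  "\<exists>\<eta>. group_hom (Frac (ForC R) 1) (Frac_monoid (F_infinity R)) \<eta> \<and>
    inj_on \<eta> (carrier (Frac (ForC R) 1)) \<and>
    (\<forall>n. \<forall>X \<in> ForC.Hom 1 n. \<forall>Y \<in> ForC.Hom 1 n. \<eta> (frac_class (ForC R) 1 X Y) =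
      frac_class (monoid_cat (F_infinity R)) () (at_root k X) (at_root k Y))"
  unfolding Frac_monoid_def
proof (rule ForC.Frac_embedding[where
      c = "\<lambda>X Y. frac_class (monoid_cat (F_infinity R)) () (at_root k X) (at_root k Y)"])
  show "group (Frac (monoid_cat (F_infinity R)) ())"
    by (rule Fcat.group_Frac)
next
  fix n X Y
  assume "X \<in> ForC.Hom 1 n" "Y \<in> ForC.Hom 1 n"
  then show "frac_class (monoid_cat (F_infinity R)) () (at_root k X) (at_root k Y)
      \<in> carrier (Frac (monoid_cat (F_infinity R)) ())"
    by (intro Fcat.frac_class_in_carrier) (simp_all add: at_root_in_carrier)
next
  fix n m X Y Z
  assume 1: "X \<in> ForC.Hom 1 n" "Y \<in> ForC.Hom 1 n" and Z: "Z \<in> ForC.Hom n m"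
  obtain t where t: "X = cls [t]" "size1 t = n"
    using 1 by (auto simp: ForC_Hom_1)
  obtain s where s: "Y = cls [s]" "size1 s = n"
    using 1 by (auto simp: ForC_Hom_1)
  obtain f where f: "Z = cls f" "length f = n"
    using Z by (auto simp: ForC_Hom)
  have "at_root k (cmp (ForC R) X Z) = at_root k X \<otimes>\<^bsub>F_infinity R\<^esub> seq_of (replicate k Leaf @ f)"
    and "at_root k (cmp (ForC R) Y Z) = at_root k Y \<otimes>\<^bsub>F_infinity R\<^esub> seq_of (replicate k Leaf @ f)"
    using t s f by (simp_all add: at_root_mult skein_comp_cls)
  then show "frac_class (monoid_cat (F_infinity R)) () (at_root k (cmp (ForC R) X Z)) (at_root k (cmp (ForC R) Y Z)) =
      frac_class (monoid_cat (F_infinity R)) () (at_root k X) (at_root k Y)"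
    using Fcat.frac_class_cmp[of "at_root k X" "()" "()" "at_root k Y" "seq_of (replicate k Leaf @ f)" "()"]
      1 by (simp add: at_root_in_carrier)
next
  fix n X Y Z
  assume "X \<in> ForC.Hom 1 n" "Y \<in> ForC.Hom 1 n" "Z \<in> ForC.Hom 1 n"
  then show "frac_class (monoid_cat (F_infinity R)) () (at_root k X) (at_root k Y)
      \<otimes>\<^bsub>Frac (monoid_cat (F_infinity R)) ()\<^esub> frac_class (monoid_cat (F_infinity R)) () (at_root k Y) (at_root k Z) =
      frac_class (monoid_cat (F_infinity R)) () (at_root k X) (at_root k Z)"
    by (intro Fcat.mult_Frac_middle[where y = "()"]) (simp_all add: at_root_in_carrier)
next
  fix n X Y
  assume 1: "X \<in> ForC.Hom 1 n" "Y \<in> ForC.Hom 1 n"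
    and one: "frac_class (monoid_cat (F_infinity R)) () (at_root k X) (at_root k Y) =
      \<one>\<^bsub>Frac (monoid_cat (F_infinity R)) ()\<^esub>"
  obtain t where t: "X = cls [t]" "size1 t = n"
    using 1 by (auto simp: ForC_Hom_1)
  obtain s where s: "Y = cls [s]" "size1 s = n"
    using 1 by (auto simp: ForC_Hom_1)
  obtain \<chi> where \<chi>: "\<chi> \<in> carrier (F_infinity R)"
      "at_root k X \<otimes>\<^bsub>F_infinity R\<^esub> \<chi> = at_root k Y \<otimes>\<^bsub>F_infinity R\<^esub> \<chi>"
    using one Fcat.frac_class_one_iff[of "at_root k X" "()" "()" "at_root k Y"] 1
    by (auto simp: at_root_in_carrier)
  obtain N where N: "\<And>m. m \<ge> N \<Longrightarrow> \<exists>h. \<chi> = seq_of h \<and> length h = m"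
    using seq_of_long[OF \<chi>(1)] by blast
  obtain h where h: "\<chi> = seq_of h" "length h = k + n + N"
    using N[of "k + n + N"] by auto
  \<comment> \<open>\<open>h\<close> is long enough to be cut at the first and the last leaf of the tree placed at root \<open>k\<close>.\<close>
  define h1 where "h1 = take k h"
  define f where "f = take n (drop k h)"
  define h2 where "h2 = drop (k + n) h"
  have len: "length h1 = k" "length f = n" "length h2 = N"
    using h(2) by (simp_all add: h1_def f_def h2_def)
  have "h = h1 @ f @ h2"
    using append_take_drop_id[of k h] append_take_drop_id[of n "drop k h"] drop_drop[of n k h]
    unfolding h1_def f_def h2_def by (simp only: add.commute[of k n])
  then have "at_root k (cls [u]) \<otimes>\<^bsub>F_infinity R\<^esub> \<chi> = seq_of (h1 @ graft u f # h2)" if "size1 u = n" for u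
  proof -
    have "at_root k (cls [u]) = seq_of (replicate k Leaf @ [u] @ replicate N Leaf)"
      using seq_of_pad[of "replicate k Leaf @ [u]" N] by (simp add: at_root_cls)
    moreover have "stack (replicate k Leaf @ [u] @ replicate N Leaf) (h1 @ f @ h2) = h1 @ graft u f # h2"
      using len that stack_replicate_Leaf_left[of h2] by (simp add: stack_replicate_Leaf_append)
    ultimately show ?thesis
      using \<open>h = _\<close> h(1) len that seq_of_mult by simp
  qed
  then have "h1 @ [graft t f] @ h2 \<approx> h1 @ [graft s f] @ h2"
    using \<chi>(2) t s by (simp add: seq_of_eq_iff)
  then have "[graft t f] \<approx> [graft s f]"
    using skein_eq_append_iff[of h1 h1] skein_eq_append_iff[of "[graft t f]" "[graft s f]" h2 h2] by simp
  then have "cmp (ForC R) X (cls f) = cmp (ForC R) Y (cls f)"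
    using t s len by (simp add: skein_comp_cls cls_eq_iff)
  moreover have "cls f \<in> ForC.Hom n (leaves f)"
    using len by (auto simp: ForC_Hom)
  ultimately show "\<exists>m. \<exists>Z\<in>ForC.Hom n m. cmp (ForC R) X Z = cmp (ForC R) Y Z"
    by blast
qed

end

section \<open>Properties of groups that pass to subgroups\<close>

text \<open>
  The injective image of \<open>H\<close> in \<open>G\<close> is a subgroup isomorphic to \<open>H\<close>.
\<close>

lemma subgroup_closed_property_inj_hom:
  assumes P: "subgroup_closed_property P" and G: "group G" and H: "group H"
    and iG: "G \<cong> A" and iH: "H \<cong> B"
    and h: "group_hom B A h" "inj_on h (carrier B)" and PG: "P G"
  shows "P H"
proof -
  obtain i where i: "i \<in> iso H B"
    using iH by (auto simp: is_iso_def)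
  obtain j where j: "j \<in> iso A G"
    using group.iso_sym[OF G iG] by (auto simp: is_iso_def)
  have hom: "j \<circ> (h \<circ> i) \<in> hom H G"
    using i j group_hom.homh[OF h(1)] by (intro hom_compose[of _ _ A] hom_compose[of _ _ B]) (auto simp: iso_def)
  have inj: "inj_on (j \<circ> (h \<circ> i)) (carrier H)"
  proof -
    have ij: "i ` carrier H = carrier B" "inj_on i (carrier H)" "inj_on j (carrier A)"
      using i j by (auto simp: iso_def bij_betw_def)
    have "(h \<circ> i) ` carrier H \<subseteq> carrier A"
      using group_hom.homh[OF h(1)] by (simp only: image_comp[symmetric] ij) (auto simp: hom_def)
    then have "inj_on j ((h \<circ> i) ` carrier H)"
      by (rule inj_on_subset[OF ij(3)])
    moreover have "inj_on (h \<circ> i) (carrier H)"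
      using ij h(2) by (simp add: comp_inj_on)
    ultimately show ?thesis
      by (rule comp_inj_on[rotated])
  qed
  let ?I = "(j \<circ> (h \<circ> i)) ` carrier H"
  have gh: "group_hom H G (j \<circ> (h \<circ> i))"
    using G H hom by (simp add: group_hom_def group_hom_axioms_def)
  have sub: "subgroup ?I G"
    by (rule group_hom.img_is_subgroup[OF gh])
  have "j \<circ> (h \<circ> i) \<in> iso H (G\<lparr>carrier := ?I\<rparr>)"
    using hom inj by (auto simp: iso_def hom_def bij_betw_def)
  then have "H \<cong> G\<lparr>carrier := ?I\<rparr>"
    by (auto simp: is_iso_def)
  then have "G\<lparr>carrier := ?I\<rparr> \<cong> H"
    by (rule group.iso_sym[OF H])
  moreover have "group (G\<lparr>carrier := ?I\<rparr>)"
    using subgroup.subgroup_is_group[OF sub G] .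
  moreover have "P (G\<lparr>carrier := ?I\<rparr>)"
    using P G sub PG unfolding subgroup_closed_property_def by blast
  ultimately show ?thesis
    using P H unfolding subgroup_closed_property_def by blast
qed

theorem proposition3p14:
  fixes R :: "('a tree \<times> 'a tree) set"
  assumes "skein_relations R"
    and "ore_category (ForC R)"
  shows "(\<forall>a :: 'a. \<exists>\<gamma>. group_hom (Frac_monoid (F_infinity R)) (Frac (ForC R) 1) \<gamma> \<and>
            inj_on \<gamma> (carrier (Frac_monoid (F_infinity R)))) \<and>
         (\<forall>k :: nat. k \<ge> 1 \<longrightarrow>
           (\<exists>\<eta>. group_hom (Frac (ForC R) 1) (Frac_monoid (F_infinity R)) \<eta> \<and>
            inj_on \<eta> (carrier (Frac (ForC R) 1)))) \<and>
         (\<forall>(P :: 'x monoid \<Rightarrow> bool) G H.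
            subgroup_closed_property P \<longrightarrow> group G \<longrightarrow> group H \<longrightarrow>
            G \<cong> Frac (ForC R) 1 \<longrightarrow> H \<cong> Frac_monoid (F_infinity R) \<longrightarrow>
            (P G \<longleftrightarrow> P H))"
proof -
  interpret ore_skein R
    using assms by unfold_locales
  have \<gamma>: "\<exists>\<gamma>. group_hom (Frac_monoid (F_infinity R)) (Frac (ForC R) 1) \<gamma> \<and>
      inj_on \<gamma> (carrier (Frac_monoid (F_infinity R)))" for a :: 'a
    using gamma_embedding[of a] by blast
  have \<eta>: "\<exists>\<eta>. group_hom (Frac (ForC R) 1) (Frac_monoid (F_infinity R)) \<eta> \<and>
      inj_on \<eta> (carrier (Frac (ForC R) 1))" for k :: nat
    \<comment> \<open>Sequences are indexed from \<open>0\<close>, so the \<open>k\<close>-th entry sits at index \<open>k - 1\<close>.\<close>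
    using eta_embedding[of "k - 1"] by blast
  have "P G \<longleftrightarrow> P H"
    if P: "subgroup_closed_property P" "group G" "group H"
      and iso: "G \<cong> Frac (ForC R) 1" "H \<cong> Frac_monoid (F_infinity R)"
    for P :: "'x monoid \<Rightarrow> bool" and G H
  proof
    show "P H" if "P G"
      using \<gamma> subgroup_closed_property_inj_hom[OF P iso _ _ that] by blast
    show "P G" if "P H"
      using \<eta> subgroup_closed_property_inj_hom[OF P(1,3,2) iso(2,1) _ _ that] by blast
  qed
  then show ?thesis
    using \<gamma> \<eta> by blast
qed

end
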